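(* Let $n\ge 1$ and let $M$ be the uncentered Hardy--Littlewood maximal operator on $\mathbb{R}^n$. There is a constant $C>0$ such that for any $f\in\mathrm{CMO}(\mathbb{R}^n)$ for which $Mf$ is not identically equal to infinity, $Mf$ also belongs to $\mathrm{CMO}(\mathbb{R}^n)$, and $$\|Mf\|_{\mathrm{BMO}(\mathbb{R}^n)}\le C\,\|f\|_{\mathrm{BMO}(\mathbb{R}^n)}.$$
   Context: $\mathrm{BMO}(\mathbb{R}^n)$ is the classical space of functions of bounded mean oscillation, $\|f\|_{\mathrm{BMO}}=\sup_B\frac1{|B|}\int_B|f-f_B|\,dx$, with $f_B=\frac1{|B|}\int_Bf$ and supremum over all balls. $\mathrm{CMO}(\mathbb{R}^n)$ is the closure of $C_c^\infty(\mathbb{R}^n)$ in $\mathrm{BMO}(\mathbb{R}^n)$ with respect to this (semi)norm. $Mf(x)=\sup_{B\ni x}\frac1{|B|}\int_B|f(y)|\,dy$, the supremum being over all balls $B$ containing $x$. *)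

theory Defs
  imports "HOL-Analysis.Analysis"
begin

definition locally_integrable :: "('a::euclidean_space \<Rightarrow> 'b::euclidean_space) \<Rightarrow> bool" where
  "locally_integrable f \<longleftrightarrow> (\<forall>K. compact K \<longrightarrow> f absolutely_integrable_on K)"

definition ball_avg :: "('a::euclidean_space \<Rightarrow> 'b::euclidean_space) \<Rightarrow> 'a \<Rightarrow> real \<Rightarrow> 'b" where
  "ball_avg f c r =
     (1 / measure lebesgue (ball c r)) *\<^sub>R (LINT y:ball c r|lebesgue. f y)"

definition mean_osc :: "('a::euclidean_space \<Rightarrow> 'b::euclidean_space) \<Rightarrow> 'a \<Rightarrow> real \<Rightarrow> real" where
  "mean_osc f c r = ball_avg (\<lambda>y. norm (f y - ball_avg f c r)) c r"

text \<open>The BMO seminorm takes values in \<open>[0, \<infinity>]\<close>; it is meaningful for locally integrable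
  functions only, since the Bochner integral of a non-integrable function is 0 by convention.\<close>

definition bmo_norm :: "('a::euclidean_space \<Rightarrow> 'b::euclidean_space) \<Rightarrow> ennreal" where
  "bmo_norm f = (SUP (c, r) \<in> UNIV \<times> {0<..}. ennreal (mean_osc f c r))"

definition BMO :: "('a::euclidean_space \<Rightarrow> 'b::euclidean_space) set" where
  "BMO = {f. locally_integrable f \<and> bmo_norm f < \<infinity>}"

text \<open>\<open>C_diff k f\<close>: \<open>f\<close> is of class \<open>C\<^sup>k\<close> on the whole space.\<close>

primrec C_diff :: "nat \<Rightarrow> ('a::euclidean_space \<Rightarrow> 'b::euclidean_space) \<Rightarrow> bool" where
  "C_diff 0 f \<longleftrightarrow> continuous_on UNIV f"
| "C_diff (Suc k) f \<longleftrightarrow>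
     (\<forall>x. f differentiable (at x)) \<and> (\<forall>v. C_diff k (\<lambda>x. frechet_derivative f (at x) v))"

definition test_functions :: "('a::euclidean_space \<Rightarrow> 'b::euclidean_space) set" where
  "test_functions = {g. (\<forall>k. C_diff k g) \<and> compact (closure {x. g x \<noteq> 0})}"

definition CMO :: "('a::euclidean_space \<Rightarrow> 'b::euclidean_space) set" where
  "CMO = {f \<in> BMO. \<forall>e>0. \<exists>g\<in>test_functions. bmo_norm (\<lambda>x. f x - g x) < ennreal e}"

definition maximal :: "('a::euclidean_space \<Rightarrow> 'b::euclidean_space) \<Rightarrow> 'a \<Rightarrow> ennreal" where
  "maximal f x =
     (SUP (c, r) \<in> {(c, r). 0 < r \<and> x \<in> ball c r}.
        (\<integral>\<^sup>+y\<in>ball c r. ennreal (norm (f y)) \<partial>lebesgue) / emeasure lebesgue (ball c r))"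

end

(*
Write w = |f| and a(B) for the mean of w over a ball B. For x in B = B(c, r), split the balls A
containing x by radius s. If s > r, concentric enlargement of A by 2r covers B, so a(A) exceeds
inf_B Mf by at most the change of mean between two nested balls. If s <= r, a stopping-time
argument with Vitali's covering lemma, run on the local maximal function itself, gives exponential
decay of the set where it exceeds a(3B) <= inf_B Mf. Hence Mf - inf_B Mf has mean O(osc of f)
over B; neither the John-Nirenberg inequality nor an L^2 bound for M is needed.

For f in CMO write f = g + h with g in C_c^infinity and h small in BMO. The same splitting then
shows that the mean oscillation of F = Mf is small on balls that are small, large, or far away.
Such an F is in CMO: replace F by its ball means at a small scale, cut off at a large radius after
subtracting a mean, and approximate the resulting C_c function uniformly by a polynomial times a
smooth bump.
*)
theory Submission
  imports Defs
begin

subsection \<open>Averages and mean oscillation over balls\<close>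

text \<open>The seminorm bound alone does not carry CMO into itself: M is not linear, and |Mf - Mg|
  <= M(f - g) does not control the mean oscillation of Mf - Mg. So approximating f by test functions
  does not reduce the claim to test functions, and the oscillation of Mf is estimated directly.
  Small balls and the other balls resist for opposite reasons. Below a small ball w oscillates
  little, but the enlarged balls can reach scales at which g oscillates; there the radii s and s +
  2r have a ratio close to 1. Around a large or distant ball the mean of |g| over the enlarged balls
  is small, but g may oscillate at smaller scales; there the stopping-time argument is run on |h|,
  and the local maximal function of |g| is bounded separately. The excess of Mf over its infimum is
  integrated in [0, infinity], so local integrability of Mf follows from the estimate instead of
  preceding it. The constant 90 is the quotient of 3r by r/30: a ball of radius at least r/30 inside
  B(c, 3r) has mean within 90^n times the oscillation over B(c, 3r) of the mean there.\<close>

lemma measure_lebesgue_ball: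
  fixes c :: "'a::euclidean_space"
  assumes "r \<ge> 0"
  shows "measure lebesgue (ball c r) = unit_ball_vol (real DIM('a)) * r ^ DIM('a)"
  using content_ball[OF assms, of c] by (simp add: measure_completion)

lemma measure_lebesgue_ball_pos:
  fixes c :: "'a::euclidean_space"
  assumes "r > 0"
  shows "measure lebesgue (ball c r) > 0"
  using assms by (simp add: measure_lebesgue_ball)

lemma emeasure_lebesgue_ball:
  fixes c :: "'a::euclidean_space"
  shows "emeasure lebesgue (ball c r) = ennreal (measure lebesgue (ball c r))"
  using emeasure_lborel_ball_finite[of c r] by (subst emeasure_eq_ennreal_measure) auto

lemma measure_lebesgue_ball_scale:
  fixes c c' :: "'a::euclidean_space"
  assumes "r \<ge> 0" "k \<ge> 0"
  shows "measure lebesgue (ball c (k * r)) = k ^ DIM('a) * measure lebesgue (ball c' r)"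
  using measure_lebesgue_ball[of "k * r" c] measure_lebesgue_ball[of r c'] assms
  by (simp only: mult_nonneg_nonneg power_mult_distrib) (simp add: ac_simps)

lemma locally_integrable_ball:
  assumes "locally_integrable f"
  shows "set_integrable lebesgue (ball c r) f"
  using assms unfolding locally_integrable_def
  by (meson ball_subset_cball compact_cball fmeasurableD lmeasurable_ball set_integrable_subset)

lemma locally_integrableI_cball:
  assumes "\<And>r. r > 0 \<Longrightarrow> set_integrable lebesgue (cball 0 r) f"
  shows "locally_integrable f"
  unfolding locally_integrable_def
proof (intro allI impI)
  fix K :: "'a set" assume K: "compact K"
  then obtain r where "r > 0" "K \<subseteq> ball 0 r"
    using bounded_subset_ballD[OF compact_imp_bounded] by blast
  then have "r > 0" "K \<subseteq> cball 0 r" by (auto simp: subset_eq less_imp_le)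
  then show "f absolutely_integrable_on K"
    using assms[of r] K set_integrable_subset by (metis fmeasurableD lmeasurable_compact)
qed

lemma locally_integrable_borel:
  fixes f :: "'a::euclidean_space \<Rightarrow> 'b::euclidean_space"
  assumes "locally_integrable f"
  shows "f \<in> borel_measurable lebesgue"
proof (rule borel_measurable_LIMSEQ_metric)
  show "(\<lambda>x. indicator (ball 0 (real n)) x *\<^sub>R f x) \<in> borel_measurable lebesgue" for n
    using locally_integrable_ball[OF assms, of 0 "real n"]
    unfolding set_integrable_def by (rule borel_measurable_integrable)
  fix x :: 'a
  obtain N where N: "norm x < real N" using reals_Archimedean2 by blast
  have "eventually (\<lambda>n. indicator (ball 0 (real n)) x *\<^sub>R f x = f x) sequentially"
    using eventually_ge_at_top[of N] by eventually_elim (use N in auto)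
  then show "(\<lambda>n. indicator (ball 0 (real n)) x *\<^sub>R f x) \<longlonglongrightarrow> f x"
    by (simp add: tendsto_eventually)
qed

lemma locally_integrable_add:
  "locally_integrable f \<Longrightarrow> locally_integrable g \<Longrightarrow> locally_integrable (\<lambda>x. f x + g x)"
  unfolding locally_integrable_def by (auto intro: set_integral_add(1))

lemma locally_integrable_diff:
  "locally_integrable f \<Longrightarrow> locally_integrable g \<Longrightarrow> locally_integrable (\<lambda>x. f x - g x)"
  unfolding locally_integrable_def by (auto intro: set_integral_diff(1))

lemma locally_integrable_norm:
  fixes f :: "'a::euclidean_space \<Rightarrow> 'b::euclidean_space"
  shows "locally_integrable f \<Longrightarrow> locally_integrable (\<lambda>x. norm (f x))"
  unfolding locally_integrable_def by (auto intro: set_integrable_norm)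

lemma locally_integrable_continuous:
  fixes f :: "'a::euclidean_space \<Rightarrow> 'b::euclidean_space"
  assumes "continuous_on UNIV f"
  shows "locally_integrable f"
  unfolding locally_integrable_def
proof (intro allI impI)
  fix K :: "'a set" assume K: "compact K"
  then obtain a b where sub: "K \<subseteq> cbox a b"
    using bounded_subset_cbox_symmetric[OF compact_imp_bounded] by blast
  have "f absolutely_integrable_on cbox a b"
    by (intro absolutely_integrable_continuous continuous_on_subset[OF assms]) simp
  then show "f absolutely_integrable_on K"
    by (rule set_integrable_subset[OF _ fmeasurableD[OF lmeasurable_compact[OF K]] sub])
qed

lemma locally_integrable_const: "locally_integrable (\<lambda>x. c)"
  by (rule locally_integrable_continuous) simp

lemma ball_avg_add:
  assumes "locally_integrable f" "locally_integrable g"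
  shows "ball_avg (\<lambda>x. f x + g x) c r = ball_avg f c r + ball_avg g c r"
  unfolding ball_avg_def using assms[THEN locally_integrable_ball, of c r]
  by (simp add: set_integral_add scaleR_add_right)

lemma ball_avg_diff:
  assumes "locally_integrable f" "locally_integrable g"
  shows "ball_avg (\<lambda>x. f x - g x) c r = ball_avg f c r - ball_avg g c r"
  unfolding ball_avg_def using assms[THEN locally_integrable_ball, of c r]
  by (simp add: set_integral_diff scaleR_diff_right)

lemma ball_avg_cmult:
  fixes f :: "'a::euclidean_space \<Rightarrow> real"
  shows "ball_avg (\<lambda>x. k * f x) c r = k * ball_avg f c r"
  unfolding ball_avg_def by simp

lemma ball_avg_const:
  assumes "r > 0"
  shows "ball_avg (\<lambda>x::'a::euclidean_space. k::'b::euclidean_space) c r = k"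
proof -
  have "(LINT y:ball c r|lebesgue. k) = measure lebesgue (ball c r) *\<^sub>R k"
    using set_integral_const[of "ball c r" lebesgue k] by (simp add: emeasure_lebesgue_ball)
  then show ?thesis
    unfolding ball_avg_def using measure_lebesgue_ball_pos[OF assms, of c] by simp
qed

lemma ball_avg_mono_on:
  fixes f :: "'a::euclidean_space \<Rightarrow> real"
  assumes "locally_integrable f" "locally_integrable g" "\<And>x. x \<in> ball c r \<Longrightarrow> f x \<le> g x"
  shows "ball_avg f c r \<le> ball_avg g c r"
  unfolding ball_avg_def real_scaleR_def
  by (intro mult_left_mono set_integral_mono assms(3) assms(1,2)[THEN locally_integrable_ball]) auto

lemma ball_avg_mono:
  fixes f :: "'a::euclidean_space \<Rightarrow> real"
  assumes "locally_integrable f" "locally_integrable g" "\<And>x. f x \<le> g x"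
  shows "ball_avg f c r \<le> ball_avg g c r"
  using assms by (auto intro: ball_avg_mono_on)

lemma ball_avg_nonneg:
  fixes f :: "'a::euclidean_space \<Rightarrow> real"
  assumes "\<And>x. f x \<ge> 0"
  shows "ball_avg f c r \<ge> 0"
  unfolding ball_avg_def set_lebesgue_integral_def using assms by simp

lemma norm_ball_avg_le:
  fixes f :: "'a::euclidean_space \<Rightarrow> 'b::euclidean_space"
  assumes "locally_integrable f"
  shows "norm (ball_avg f c r) \<le> ball_avg (\<lambda>x. norm (f x)) c r"
proof -
  have "norm (LINT y:ball c r|lebesgue. f y) \<le> (LINT y:ball c r|lebesgue. norm (f y))"
    using set_integral_norm_bound[OF locally_integrable_ball[OF assms, of c r]] by simp
  then show ?thesis unfolding ball_avg_def by (simp add: divide_right_mono)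
qed

text \<open>Bridge between the Bochner mean and the nonnegative integral. Estimates with densities
  or unions of balls are done in \<open>ennreal\<close>; the measure of the ball, positive and
  finite, is cancelled at the end.\<close>

lemma ball_avg_eq_nn_integral:
  fixes f :: "'a::euclidean_space \<Rightarrow> real"
  assumes "locally_integrable f" "\<And>x. f x \<ge> 0" "r > 0"
  shows "(\<integral>\<^sup>+y\<in>ball c r. ennreal (f y) \<partial>lebesgue)
    = ennreal (ball_avg f c r) * emeasure lebesgue (ball c r)"
proof -
  have eq: "ennreal (indicat_real (ball c r) y * f y) = ennreal (f y) * indicator (ball c r) y" for y
    by (cases "y \<in> ball c r") auto
  have "(\<integral>\<^sup>+y\<in>ball c r. ennreal (f y) \<partial>lebesgue) = ennreal (LINT y:ball c r|lebesgue. f y)"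
    using nn_integral_eq_integral[OF locally_integrable_ball[OF assms(1), of c r, unfolded set_integrable_def]]
      assms(2) unfolding set_lebesgue_integral_def
    by (simp add: eq)
  also have "(LINT y:ball c r|lebesgue. f y) = ball_avg f c r * measure lebesgue (ball c r)"
    unfolding ball_avg_def using measure_lebesgue_ball_pos[OF assms(3), of c] by simp
  also have "ennreal \<dots> = ennreal (ball_avg f c r) * emeasure lebesgue (ball c r)"
    by (simp add: emeasure_lebesgue_ball ennreal_mult ball_avg_nonneg assms(2))
  finally show ?thesis .
qed

text \<open>For a nonnegative function the smaller ball has the smaller integral, and
  \<open>r \<le> k * s\<close> bounds the quotient of volumes by k^n. This factor tends to 1 as
  \<open>k\<close> does, which the estimate for small balls exploits.\<close>

lemma ball_avg_subset:
  fixes f :: "'a::euclidean_space \<Rightarrow> real"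
  assumes "locally_integrable f" "\<And>x. f x \<ge> 0" "s > 0" "ball z s \<subseteq> ball c r" "r \<le> k * s"
  shows "ball_avg f z s \<le> k ^ DIM('a) * ball_avg f c r"
proof -
  have "r > 0" using assms(3,4) by (metis ball_eq_empty not_le subset_empty)
  have k: "k > 0" using \<open>r > 0\<close> assms(3,5) by (meson less_le_trans zero_less_mult_pos2)
  let ?I = "\<lambda>c r. LINT y:ball c r|lebesgue. f y" and ?V = "\<lambda>c r. measure lebesgue (ball c r)"
  have I: "?I z s \<le> ?I c r"
    unfolding set_lebesgue_integral_def
    using locally_integrable_ball[OF assms(1)] assms(2,4) unfolding set_integrable_def
    by (intro integral_mono) (auto simp: indicator_def)
  have I0: "0 \<le> ?I c r" using assms(2) unfolding set_lebesgue_integral_def by simp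
  have V: "?V c r \<le> k ^ DIM('a) * ?V z s"
  proof -
    have "?V c r \<le> ?V c (k * s)"
      using assms(5) by (intro measure_mono_fmeasurable subset_ball) auto
    also have "\<dots> = k ^ DIM('a) * ?V z s"
      using assms(3) k by (intro measure_lebesgue_ball_scale) auto
    finally show ?thesis .
  qed
  have Vp: "?V c r > 0" "?V z s > 0" using assms \<open>r > 0\<close> by (auto intro: measure_lebesgue_ball_pos)
  have "?I z s * ?V c r \<le> ?I c r * (k ^ DIM('a) * ?V z s)"
    using I V I0 Vp by (intro mult_mono) auto
  then show ?thesis
    unfolding ball_avg_def using Vp by (simp add: field_simps)
qed

lemma norm_ball_avg_diff_le:
  fixes f :: "'a::euclidean_space \<Rightarrow> 'b::euclidean_space"
  assumes "locally_integrable f" "r > 0"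
  shows "norm (ball_avg f c r - k) \<le> ball_avg (\<lambda>x. norm (f x - k)) c r"
proof -
  have "ball_avg f c r - k = ball_avg (\<lambda>x. f x - k) c r"
    using assms by (simp add: ball_avg_diff locally_integrable_const ball_avg_const)
  then show ?thesis
    using norm_ball_avg_le[OF locally_integrable_diff[OF assms(1) locally_integrable_const]] by simp
qed

section \<open>Calculus of mean oscillation\<close>

lemma mean_osc_nonneg: "mean_osc f c r \<ge> 0"
  unfolding mean_osc_def by (auto intro: ball_avg_nonneg)

text \<open>The mean is no farther from \<open>k\<close> than the average of
  \<open>norm (f x - k)\<close>, so recentring costs a factor 2. Later estimates can thus compare
  with an infimum, a value at the centre or a product.\<close>

lemma mean_osc_le:
  fixes f :: "'a::euclidean_space \<Rightarrow> 'b::euclidean_space"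
  assumes f: "locally_integrable f" and "r > 0"
  shows "mean_osc f c r \<le> 2 * ball_avg (\<lambda>x. norm (f x - k)) c r"
proof -
  let ?a = "ball_avg f c r"
  note li = locally_integrable_norm[OF locally_integrable_diff[OF f locally_integrable_const]]
  have "mean_osc f c r \<le> ball_avg (\<lambda>x. norm (f x - k) + norm (?a - k)) c r"
    unfolding mean_osc_def
  proof (intro ball_avg_mono li locally_integrable_add locally_integrable_const)
    show "norm (f x - ?a) \<le> norm (f x - k) + norm (?a - k)" for x
      using norm_triangle_ineq4[of "f x - k" "?a - k"] by simp
  qed
  also have "\<dots> = ball_avg (\<lambda>x. norm (f x - k)) c r + norm (?a - k)"
    using ball_avg_add[OF li locally_integrable_const] ball_avg_const[OF assms(2)] by simp
  also have "\<dots> \<le> 2 * ball_avg (\<lambda>x. norm (f x - k)) c r"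
    using norm_ball_avg_diff_le[OF assms] by simp
  finally show ?thesis .
qed

lemma mean_osc_le_avg:
  fixes f :: "'a::euclidean_space \<Rightarrow> 'b::euclidean_space"
  assumes "locally_integrable f" and "r > 0"
  shows "mean_osc f c r \<le> 2 * ball_avg (\<lambda>x. norm (f x)) c r"
  using mean_osc_le[OF assms, of c 0] by simp

lemma mean_osc_add_le:
  fixes f :: "'a::euclidean_space \<Rightarrow> 'b::euclidean_space"
  assumes f: "locally_integrable f" and g: "locally_integrable g"
  shows "mean_osc (\<lambda>x. f x + g x) c r \<le> mean_osc f c r + mean_osc g c r"
proof -
  note li = locally_integrable_norm[OF locally_integrable_diff[OF f locally_integrable_const]]
    locally_integrable_norm[OF locally_integrable_diff[OF g locally_integrable_const]]
    locally_integrable_norm[OF locally_integrable_diff[OF locally_integrable_add[OF f g] locally_integrable_const]]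
  show ?thesis
    unfolding mean_osc_def ball_avg_add[OF f g] ball_avg_add[OF li(1,2), symmetric]
  proof (intro ball_avg_mono li locally_integrable_add)
    show "norm (f x + g x - (ball_avg f c r + ball_avg g c r))
        \<le> norm (f x - ball_avg f c r) + norm (g x - ball_avg g c r)" for x
      unfolding add_diff_add by (rule norm_triangle_ineq)
  qed
qed

lemma mean_osc_minus: "mean_osc (\<lambda>x. - f x) c r = mean_osc f c r"
proof -
  have "ball_avg (\<lambda>x. - f x) c r = - ball_avg f c r"
    unfolding ball_avg_def set_lebesgue_integral_def by simp
  then show ?thesis unfolding mean_osc_def by (simp add: norm_minus_commute)
qed

lemma mean_osc_diff_le:
  fixes f :: "'a::euclidean_space \<Rightarrow> 'b::euclidean_space"
  assumes f: "locally_integrable f" and g: "locally_integrable g"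
  shows "mean_osc (\<lambda>x. f x - g x) c r \<le> mean_osc f c r + mean_osc g c r"
proof -
  have "locally_integrable (\<lambda>x. - g x)"
    using locally_integrable_diff[OF locally_integrable_const g, of 0] by simp
  from mean_osc_add_le[OF f this, of c r] show ?thesis by (simp add: mean_osc_minus)
qed

lemma mean_osc_diff_const:
  fixes f :: "'a::euclidean_space \<Rightarrow> 'b::euclidean_space"
  assumes f: "locally_integrable f" and "r > 0"
  shows "mean_osc (\<lambda>x. f x - k) c r = mean_osc f c r"
  using assms unfolding mean_osc_def
  by (simp add: ball_avg_diff locally_integrable_const ball_avg_const)

text \<open>Reverse triangle inequality with the norm of the mean as centre; the 2 is the price of
  recentring.\<close>

lemma mean_osc_norm_le:
  fixes f :: "'a::euclidean_space \<Rightarrow> 'b::euclidean_space"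
  assumes f: "locally_integrable f" and "r > 0"
  shows "mean_osc (\<lambda>x. norm (f x)) c r \<le> 2 * mean_osc f c r"
proof -
  note li = locally_integrable_norm[OF locally_integrable_diff[OF f locally_integrable_const]]
    locally_integrable_norm[OF locally_integrable_diff[OF locally_integrable_norm[OF f] locally_integrable_const]]
  have "mean_osc (\<lambda>x. norm (f x)) c r
      \<le> 2 * ball_avg (\<lambda>x. norm (norm (f x) - norm (ball_avg f c r))) c r"
    by (rule mean_osc_le[OF locally_integrable_norm[OF f] assms(2)])
  also have "\<dots> \<le> 2 * mean_osc f c r"
    unfolding mean_osc_def
    by (intro mult_left_mono ball_avg_mono li) (auto intro: norm_triangle_ineq3)
  finally show ?thesis .
qed

text \<open>Averages the deviation from the larger ball's mean over the smaller ball, then enlarges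
  the ball by nonnegativity. Most of the constants k^n below arise here.\<close>

lemma ball_avg_nested_le:
  fixes w :: "'a::euclidean_space \<Rightarrow> real"
  assumes w: "locally_integrable w" and "s > 0" "ball z s \<subseteq> ball c r" "r \<le> k * s"
  shows "\<bar>ball_avg w z s - ball_avg w c r\<bar> \<le> k ^ DIM('a) * mean_osc w c r"
proof -
  have "\<bar>ball_avg w z s - ball_avg w c r\<bar> \<le> ball_avg (\<lambda>x. norm (w x - ball_avg w c r)) z s"
    using norm_ball_avg_diff_le[OF w assms(2), of z "ball_avg w c r"] by simp
  also have "\<dots> \<le> k ^ DIM('a) * mean_osc w c r"
    unfolding mean_osc_def
    by (intro ball_avg_subset assms locally_integrable_norm locally_integrable_diff
        locally_integrable_const) auto
  finally show ?thesis .
qed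

lemma bmo_norm_le_iff:
  assumes "b \<ge> 0"
  shows "bmo_norm f \<le> ennreal b \<longleftrightarrow> (\<forall>c r. r > 0 \<longrightarrow> mean_osc f c r \<le> b)"
  unfolding bmo_norm_def by (auto simp: SUP_le_iff assms)

subsection \<open>A covering principle\<close>

text \<open>The sum is an integral over a counting measure, so that the family selected by Vitali's
  lemma needs no enumeration. The indicator of a union is at most the sum of the indicators;
  integrate and exchange.\<close>

lemma emeasure_UN_countable_le:
  assumes sets [measurable]: "\<And>i. i \<in> I \<Longrightarrow> X i \<in> sets M" and I [simp]: "countable I"
  shows "emeasure M (\<Union>(X ` I)) \<le> (\<integral>\<^sup>+i. emeasure M (X i) \<partial>count_space I)"
proof -
  have le: "indicator (\<Union>(X ` I)) x \<le> (\<integral>\<^sup>+i. indicator (X i) x \<partial>count_space I)" for x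
  proof (cases "x \<in> \<Union>(X ` I)")
    case True
    then obtain j where j: "j \<in> I" "x \<in> X j" by blast
    have "(1::ennreal) = (\<integral>\<^sup>+i. indicator {j} i \<partial>count_space I)"
      using j(1) by simp
    also have "\<dots> \<le> (\<integral>\<^sup>+i. indicator (X i) x \<partial>count_space I)"
      by (intro nn_integral_mono) (use j in \<open>auto simp: indicator_def\<close>)
    finally show ?thesis using True by simp
  qed simp
  note sets.countable_UN'[unfolded subset_eq, measurable]
  have "emeasure M (\<Union>(X ` I)) = (\<integral>\<^sup>+x. indicator (\<Union>(X ` I)) x \<partial>M)"
    by simp
  also have "\<dots> \<le> (\<integral>\<^sup>+x. \<integral>\<^sup>+i. indicator (X i) x \<partial>count_space I \<partial>M)"
    by (intro nn_integral_mono le)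
  also have "\<dots> = (\<integral>\<^sup>+i. \<integral>\<^sup>+x. indicator (X i) x \<partial>M \<partial>count_space I)"
    by (simp add: nn_integral_count_space_nn_integral)
  finally show ?thesis
    by (simp cong: nn_integral_cong_simp)
qed

text \<open>Vitali's lemma selects disjoint balls whose five-fold dilates cover \<open>E\<close>;
  the local bound is summed over them, and disjointness turns the \<open>\<mu>\<close>-sum into the
  measure of a union. With two measures it serves twice: once \<open>\<nu>\<close> is Lebesgue
  measure and \<open>\<mu>\<close> has a density, once it is \<open>\<nu>\<close> that measures a
  deviation.\<close>

lemma vitali_cover_bound:
  fixes K :: "('a::euclidean_space \<times> real) set"
  assumes sets: "sets \<mu> = sets lebesgue" "sets \<nu> = sets lebesgue"
    and K: "\<And>z s. (z, s) \<in> K \<Longrightarrow> 0 < s \<and> s \<le> R"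
    and E: "E \<in> sets lebesgue" "E \<subseteq> (\<Union>(z, s)\<in>K. ball z s)"
    and le: "\<And>z s. (z, s) \<in> K \<Longrightarrow> emeasure \<nu> (E \<inter> ball z (5 * s)) \<le> emeasure \<mu> (ball z s)"
  shows "emeasure \<nu> E \<le> emeasure \<mu> (\<Union>(z, s)\<in>K. ball z s)"
proof -
  have open_sets: "S \<in> sets lebesgue" if "open S" for S :: "'a set"
    using that by (simp add: borel_open)
  obtain C where C: "countable C" "C \<subseteq> K"
     "pairwise (\<lambda>i j. disjnt (ball (fst i) (snd i)) (ball (fst j) (snd j))) C"
     "E \<subseteq> (\<Union>i\<in>C. ball (fst i) (5 * snd i))"
  proof (rule Vitali_covering_lemma_balls[of E fst snd K R])
    show "E \<subseteq> (\<Union>i\<in>K. ball (fst i) (snd i))" using E(2) by (simp add: case_prod_unfold)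
    show "0 < snd i \<and> snd i \<le> R" if "i \<in> K" for i using K[of "fst i" "snd i"] that by simp
  qed
  have "emeasure \<nu> E = emeasure \<nu> (\<Union>i\<in>C. E \<inter> ball (fst i) (5 * snd i))"
    using C(4) by (metis Int_UN_distrib inf.absorb1)
  also have "\<dots> \<le> (\<integral>\<^sup>+i. emeasure \<nu> (E \<inter> ball (fst i) (5 * snd i)) \<partial>count_space C)"
    by (rule emeasure_UN_countable_le[OF _ C(1)]) (simp only: sets sets.Int E(1) open_sets open_ball)
  also have "\<dots> \<le> (\<integral>\<^sup>+i. emeasure \<mu> (ball (fst i) (snd i)) \<partial>count_space C)"
  proof (intro nn_integral_mono)
    fix i assume "i \<in> space (count_space C)"
    then have "(fst i, snd i) \<in> K" using C(2) by auto
    then show "emeasure \<nu> (E \<inter> ball (fst i) (5 * snd i)) \<le> emeasure \<mu> (ball (fst i) (snd i))"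
      by (rule le)
  qed
  also have "\<dots> = emeasure \<mu> (\<Union>i\<in>C. ball (fst i) (snd i))"
  proof (rule emeasure_UN_countable[symmetric, OF _ C(1)])
    show "ball (fst i) (snd i) \<in> sets \<mu>" for i by (simp only: sets open_sets open_ball)
    show "disjoint_family_on (\<lambda>i. ball (fst i) (snd i)) C"
      using C(3) unfolding disjoint_family_on_def pairwise_def disjnt_def by blast
  qed
  also have "\<dots> \<le> emeasure \<mu> (\<Union>(z, s)\<in>K. ball z s)"
  proof (rule emeasure_mono)
    show "(\<Union>i\<in>C. ball (fst i) (snd i)) \<subseteq> (\<Union>(z, s)\<in>K. ball z s)"
      using C(2) by (auto simp: case_prod_unfold)
    show "(\<Union>(z, s)\<in>K. ball z s) \<in> sets \<mu>"
      unfolding sets by (intro open_sets open_UN) auto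
  qed
  finally show ?thesis .
qed

lemma ball_in_sets_lebesgue [measurable]: "ball c r \<in> sets lebesgue"
  by (simp add: borel_open)

lemma ball_avg_dilate_le:
  fixes w :: "'a::euclidean_space \<Rightarrow> real"
  assumes "locally_integrable w" "s > 0" "k \<ge> 1"
  shows "\<bar>ball_avg w z s - ball_avg w z (k * s)\<bar> \<le> k ^ DIM('a) * mean_osc w z (k * s)"
  using assms by (intro ball_avg_nested_le subset_ball) auto

subsection \<open>Exponential decay for the local maximal function\<close>

text \<open>Uncentered but limited in radius: a ball counted at a point of \<open>ball c r\<close>
  lies in \<open>ball c (3 * r)\<close>, which makes the mean over that triple ball the reference
  value below.\<close>

definition maximal_upto :: "('a::euclidean_space \<Rightarrow> real) \<Rightarrow> real \<Rightarrow> 'a \<Rightarrow> ennreal" where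
  "maximal_upto w r x =
     (SUP (z, s) \<in> {(z, s). 0 < s \<and> s \<le> r \<and> x \<in> ball z s}. ennreal (ball_avg w z s))"

lemma less_maximal_upto_iff:
  "t < maximal_upto w r x \<longleftrightarrow>
     (\<exists>z s. 0 < s \<and> s \<le> r \<and> x \<in> ball z s \<and> t < ennreal (ball_avg w z s))"
  unfolding maximal_upto_def by (auto simp: less_SUP_iff)

text \<open>Since the balls are open and need not be centred, superlevel sets are unions of open
  balls.\<close>

lemma borel_measurable_maximal_upto [measurable]: "maximal_upto w r \<in> borel_measurable lebesgue"
proof (rule borel_measurableI_greater)
  fix t
  have "{x. t < maximal_upto w r x} =
      (\<Union>(z, s)\<in>{(z, s). 0 < s \<and> s \<le> r \<and> t < ennreal (ball_avg w z s)}. ball z s)"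
    by (auto simp: less_maximal_upto_iff) blast+
  also have "open \<dots>" by (intro open_UN) auto
  finally show "{x \<in> space lebesgue. t < maximal_upto w r x} \<in> sets lebesgue"
    by (simp add: borel_open)
qed

lemma ball_avg_diff_le:
  fixes w :: "'a::euclidean_space \<Rightarrow> real"
  assumes w: "locally_integrable w" and "s > 0"
  shows "ball_avg w z s - a \<le> ball_avg (\<lambda>x. \<bar>w x - a\<bar>) z s"
  using norm_ball_avg_diff_le[OF assms, of z a] by simp

text \<open>Induction on \<open>k\<close> for all balls of radius at most \<open>\<rho>\<close> at
  once. A point above level \<open>Suc k\<close> lies in an almost maximal ball with mean above
  \<open>a + L * e\<close>. Near that ball the reference value has risen by at most
  \<open>L * e\<close>, so the case \<open>k\<close> leaves at most 2^-k 10^n times its measure.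
  Such balls, when disjoint, have total measure at most the integral of |w - a| over
  \<open>ball c (3 * r)\<close> divided by \<open>L * e\<close>, hence 3^n / L times that of
  \<open>ball c r\<close>. A level has height \<open>2 * L * e\<close>: one \<open>L * e\<close> is
  the threshold of \<open>A\<close>, the other is lost when a ball is doubled.\<close>

lemma maximal_upto_decay:
  fixes w :: "'a::euclidean_space \<Rightarrow> real"
  assumes w: "locally_integrable w" and w0: "\<And>x. w x \<ge> 0" and e: "e > 0"
    and osc: "\<And>z s. 0 < s \<Longrightarrow> s \<le> 3 * \<rho> \<Longrightarrow> mean_osc w z s \<le> e"
    and L: "L = 2 * 90 ^ DIM('a)"
    and r: "0 < r" "r \<le> \<rho>"
  shows "emeasure lebesgue {x \<in> ball c r. ennreal (ball_avg w c (3 * r) + 2 * L * e * real k)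
      < maximal_upto w r x} \<le> ennreal ((1 / 2) ^ k) * emeasure lebesgue (ball c r)"
  using r
proof (induction k arbitrary: c r)
  case 0
  have "emeasure lebesgue {x \<in> ball c r. ennreal (ball_avg w c (3 * r) + 2 * L * e * real 0)
      < maximal_upto w r x} \<le> emeasure lebesgue (ball c r)"
    by (rule emeasure_mono) auto
  then show ?case by simp
next
  case (Suc k)
  note r = Suc.prems
  define a where "a = ball_avg w c (3 * r)"
  define A where "A = {(z, s). 0 < s \<and> s \<le> r \<and> ball z s \<inter> ball c r \<noteq> {} \<and> a + L * e < ball_avg w z s}"
  (* Maximality up to a factor 2: doubling a ball of K leaves A, which bounds the mean over the
     dilates of the ball and confines the relevant balls near it to comparable radii. *)
  define K where "K = {(z, s). (z, s) \<in> A \<and> (\<forall>z' s'. (z', s') \<in> A \<longrightarrow> ball z s \<subseteq> ball z' s' \<longrightarrow> s' < 2 * s)}"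
  define E where "E = {x \<in> ball c r. ennreal (a + 2 * L * e * real (Suc k)) < maximal_upto w r x}"
  \<comment> \<open>Normalised so that a ball on which w has mean at least \<open>a + L * e\<close>
    has \<open>\<mu>\<close>-measure at least 2^-k 10^n times its Lebesgue measure, which is what
    the induction hypothesis leaves.\<close>
  define \<beta> where "\<beta> = (1 / 2) ^ k * 10 ^ DIM('a) / (L * e)"
  define \<mu> where "\<mu> = density lebesgue (\<lambda>x. ennreal (\<beta> * \<bar>w x - a\<bar>))"
  have a0: "a \<ge> 0" unfolding a_def by (rule ball_avg_nonneg[OF w0])
  have L0: "L > 0" unfolding L by simp
  have Le: "L * e > 0" using L0 e by simp
  have Lek: "L * e * real k \<ge> 0" by (intro mult_nonneg_nonneg less_imp_le[OF Le]) simp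
  have \<beta>0: "\<beta> \<ge> 0" unfolding \<beta>_def using Le by simp
  have [measurable]: "w \<in> borel_measurable lebesgue" by (rule locally_integrable_borel[OF w])
  have li: "locally_integrable (\<lambda>x. \<beta> * \<bar>w x - a\<bar>)"
  proof -
    have "locally_integrable (\<lambda>x. norm (w x - a))"
      by (intro locally_integrable_norm locally_integrable_diff w locally_integrable_const)
    then show ?thesis unfolding locally_integrable_def by simp
  qed
  have sub3: "ball z s \<subseteq> ball c (3 * r)" if "s \<le> r" "ball z s \<inter> ball c r \<noteq> {}" for z s
  proof
    from that(2) obtain x where x: "dist z x < s" "dist c x < r" by auto
    fix y assume "y \<in> ball z s"
    then show "y \<in> ball c (3 * r)"
      using x that(1) dist_triangle[of c y x] dist_triangle[of x y z] by (simp add: dist_commute)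
  qed
  \<comment> \<open>A radius of at least r/30 has ratio at most 90 to \<open>3 * r\<close>; the
    nested means would differ by at most 90^n e, less than the excess \<open>L * e\<close> required
    in \<open>A\<close>.\<close>
  have small: "30 * s < r" if "(z, s) \<in> A" for z s
  proof (rule ccontr)
    assume "\<not> 30 * s < r"
    then have "\<bar>ball_avg w z s - a\<bar> \<le> 90 ^ DIM('a) * mean_osc w c (3 * r)"
      using that r sub3 unfolding a_def A_def by (intro ball_avg_nested_le w) auto
    also have "\<dots> \<le> 90 ^ DIM('a) * e" using r by (intro mult_left_mono osc) auto
    also have "\<dots> < L * e" using e by (simp add: L)
    finally have "ball_avg w z s - a < L * e" by linarith
    moreover have "a + L * e < ball_avg w z s" using that by (simp add: A_def)
    ultimately show False by linarith
  qed
  \<comment> \<open>Among the balls of \<open>A\<close> containing the given one the radii are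
    bounded by \<open>r\<close>; one whose radius exceeds half the supremum cannot lie in another of
    twice its radius.\<close>
  have cover: "\<exists>z' s'. (z', s') \<in> K \<and> ball z s \<subseteq> ball z' s'" if zs: "(z, s) \<in> A" for z s
  proof -
    define S where "S = {s'. \<exists>z'. (z', s') \<in> A \<and> ball z s \<subseteq> ball z' s'}"
    have S: "s \<in> S" "bdd_above S" unfolding S_def using zs by (auto simp: A_def intro!: bdd_aboveI[of _ r])
    have pos: "s > 0" using zs by (simp add: A_def)
    have le: "s' \<le> Sup S" if "s' \<in> S" for s' using S that by (simp add: cSup_upper)
    have "Sup S / 2 < Sup S" using le[OF S(1)] pos by simp
    then obtain s' where s': "s' \<in> S" "Sup S / 2 < s'" using S less_cSup_iff[OF _ S(2)] by blast
    then obtain z' where z': "(z', s') \<in> A" "ball z s \<subseteq> ball z' s'" unfolding S_def by auto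
    have "s'' < 2 * s'" if "(z'', s'') \<in> A" "ball z' s' \<subseteq> ball z'' s''" for z'' s''
    proof -
      have "s'' \<in> S" unfolding S_def using that z'(2) by blast
      then show ?thesis using le[of s''] s'(2) by simp
    qed
    then show ?thesis using z' unfolding K_def by blast
  qed
  have AI: "\<exists>z s. (z, s) \<in> A \<and> x \<in> ball z s \<and> a + 2 * L * e * real (Suc k) < ball_avg w z s"
    if "x \<in> E" for x
  proof -
    from that obtain z s where zs: "0 < s" "s \<le> r" "x \<in> ball z s" "x \<in> ball c r"
        "ennreal (a + 2 * L * e * real (Suc k)) < ennreal (ball_avg w z s)"
      unfolding E_def by (auto simp: less_maximal_upto_iff)
    have gt: "a + 2 * L * e * real (Suc k) < ball_avg w z s"
      using zs(5) a0 Le by (subst (asm) ennreal_less_iff) auto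
    have "L * e * 1 \<le> L * e * (2 * real (Suc k))" using Le by (intro mult_left_mono) auto
    then have "L * e \<le> 2 * L * e * real (Suc k)" by (simp add: ac_simps)
    then show ?thesis using zs gt unfolding A_def by (intro exI[of _ z] exI[of _ s]) auto
  qed
  have E_meas: "E \<in> sets lebesgue" unfolding E_def by measurable
  have "emeasure lebesgue E \<le> emeasure \<mu> (\<Union>(z, s)\<in>K. ball z s)"
  proof (rule vitali_cover_bound[where R = r])
    show "E \<subseteq> (\<Union>(z, s)\<in>K. ball z s)"
    proof
      fix x assume "x \<in> E"
      from AI[OF this] cover show "x \<in> (\<Union>(z, s)\<in>K. ball z s)" by blast
    qed
    show "0 < s \<and> s \<le> r" if "(z, s) \<in> K" for z s using that by (simp add: K_def A_def)
    fix z s assume K: "(z, s) \<in> K"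
    then have zs: "0 < s" "s \<le> r" "ball z s \<inter> ball c r \<noteq> {}" "a + L * e < ball_avg w z s"
      and zA: "(z, s) \<in> A" and max: "\<And>z' s'. (z', s') \<in> A \<Longrightarrow> ball z s \<subseteq> ball z' s' \<Longrightarrow> s' < 2 * s"
      by (auto simp: K_def A_def)
    have s30: "30 * s < r" by (rule small[OF zA])
    have avg30: "ball_avg w z (30 * s) \<le> a + L * e"
    proof (rule ccontr)
      assume "\<not> ?thesis"
      moreover have sub: "ball z s \<subseteq> ball z (30 * s)" using zs(1) by (intro subset_ball) simp
      ultimately have "(z, 30 * s) \<in> A" using zs s30 unfolding A_def by auto
      from max[OF this sub] zs(1) show False by simp
    qed
    \<comment> \<open>Prepares the induction hypothesis for \<open>ball z (10 * s)\<close>: its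
      reference ball has radius \<open>30 * s\<close>, where \<open>avg30\<close> applies, and the
      balls that matter at points of \<open>ball z (5 * s)\<close> turn out to have radius at most
      \<open>10 * s\<close>.\<close>
    have "E \<inter> ball z (5 * s) \<subseteq> {x \<in> ball z (10 * s).
        ennreal (ball_avg w z (3 * (10 * s)) + 2 * L * e * real k) < maximal_upto w (10 * s) x}"
    proof
      fix x assume x: "x \<in> E \<inter> ball z (5 * s)"
      then obtain z' s' where z': "(z', s') \<in> A" "x \<in> ball z' s'"
          "a + 2 * L * e * real (Suc k) < ball_avg w z' s'" using AI[of x] by blast
      have xc: "x \<in> ball c r" using x by (simp add: E_def)
      have s': "0 < s'" "30 * s' < r" using z' small[OF z'(1)] by (auto simp: A_def)
      \<comment> \<open>Otherwise s' + 6s < 2s', so doubling the ball makes it contain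
        \<open>ball z s\<close>. Its mean drops by less than \<open>L * e\<close>, so it stays in
        \<open>A\<close>, against the choice of \<open>ball z s\<close>.\<close>
      have "s' \<le> 10 * s"
      proof (rule ccontr)
        assume "\<not> s' \<le> 10 * s"
        have sub: "ball z s \<subseteq> ball z' (2 * s')"
        proof
          fix y assume "y \<in> ball z s"
          then show "y \<in> ball z' (2 * s')"
            using x z'(2) zs(1) \<open>\<not> s' \<le> 10 * s\<close> dist_triangle[of z' y x] dist_triangle[of x y z]
            by (simp add: dist_commute)
        qed
        have "\<bar>ball_avg w z' s' - ball_avg w z' (2 * s')\<bar> \<le> 2 ^ DIM('a) * mean_osc w z' (2 * s')"
          using s' by (intro ball_avg_dilate_le w) auto
        also have "\<dots> \<le> 90 ^ DIM('a) * e"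
          using s' r by (intro mult_mono osc power_mono) (auto simp: mean_osc_nonneg)
        also have "\<dots> < L * e" using e by (simp add: L)
        finally have "ball_avg w z' (2 * s') > a + 2 * L * e * real (Suc k) - L * e"
          using z'(3) by simp
        moreover have "a + 2 * L * e * real (Suc k) - L * e \<ge> a + L * e"
          using Lek by (simp add: algebra_simps)
        moreover have "x \<in> ball z' (2 * s')" using z'(2) s'(1) by simp
        ultimately have "(z', 2 * s') \<in> A" using s' xc unfolding A_def by auto
        from max[OF this sub] \<open>\<not> s' \<le> 10 * s\<close> zs(1) show False by simp
      qed
      moreover have "ennreal (ball_avg w z (3 * (10 * s)) + 2 * L * e * real k) < ennreal (ball_avg w z' s')"
      proof (rule ennreal_lessI)
        have "ball_avg w z (30 * s) + 2 * L * e * real k \<le> a + L * e + 2 * L * e * real k"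
          using avg30 by simp
        also have "\<dots> < a + 2 * L * e * real (Suc k)" using Le Lek by (simp add: algebra_simps)
        also have "\<dots> < ball_avg w z' s'" by (rule z'(3))
        finally show "ball_avg w z (3 * (10 * s)) + 2 * L * e * real k < ball_avg w z' s'" by simp
        show "0 < ball_avg w z' s'"
          using z'(3) a0 Le Lek by (simp add: algebra_simps)
      qed
      ultimately have "ennreal (ball_avg w z (3 * (10 * s)) + 2 * L * e * real k) < maximal_upto w (10 * s) x"
        unfolding less_maximal_upto_iff using z'(2) s' by blast
      then show "x \<in> {x \<in> ball z (10 * s).
          ennreal (ball_avg w z (3 * (10 * s)) + 2 * L * e * real k) < maximal_upto w (10 * s) x}"
        using x zs(1) by auto
    qed
    then have "emeasure lebesgue (E \<inter> ball z (5 * s)) \<le> emeasure lebesgue {x \<in> ball z (10 * s).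
        ennreal (ball_avg w z (3 * (10 * s)) + 2 * L * e * real k) < maximal_upto w (10 * s) x}"
      by (rule emeasure_mono) measurable
    also have "\<dots> \<le> ennreal ((1 / 2) ^ k) * emeasure lebesgue (ball z (10 * s))"
      using zs(1) s30 r by (intro Suc.IH) auto
    also have "\<dots> = ennreal ((1 / 2) ^ k * 10 ^ DIM('a)) * emeasure lebesgue (ball z s)"
      unfolding emeasure_lebesgue_ball using zs(1) measure_lebesgue_ball_scale[of s 10 z z]
      by (simp add: ennreal_mult[symmetric] del: measure_completion)
    also have "\<dots> \<le> ennreal (ball_avg (\<lambda>x. \<beta> * \<bar>w x - a\<bar>) z s) * emeasure lebesgue (ball z s)"
    proof (intro mult_right_mono ennreal_leI)
      have "(1 / 2) ^ k * 10 ^ DIM('a) = \<beta> * (L * e)" unfolding \<beta>_def using L0 e by simp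
      also have "\<dots> \<le> \<beta> * (ball_avg w z s - a)" using zs(4) \<beta>0 by (intro mult_left_mono) auto
      also have "\<dots> \<le> \<beta> * ball_avg (\<lambda>x. \<bar>w x - a\<bar>) z s"
        by (intro mult_left_mono ball_avg_diff_le w zs \<beta>0)
      also have "\<dots> = ball_avg (\<lambda>x. \<beta> * \<bar>w x - a\<bar>) z s" by (simp add: ball_avg_cmult)
      finally show "(1 / 2) ^ k * 10 ^ DIM('a) \<le> ball_avg (\<lambda>x. \<beta> * \<bar>w x - a\<bar>) z s" .
    qed simp
    also have "\<dots> = (\<integral>\<^sup>+x\<in>ball z s. ennreal (\<beta> * \<bar>w x - a\<bar>) \<partial>lebesgue)"
      by (rule ball_avg_eq_nn_integral[symmetric]) (use li zs \<beta>0 in auto)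
    also have "\<dots> = emeasure \<mu> (ball z s)" unfolding \<mu>_def by (subst emeasure_density) auto
    finally show "emeasure lebesgue (E \<inter> ball z (5 * s)) \<le> emeasure \<mu> (ball z s)" .
  qed (use E_meas in \<open>auto simp: \<mu>_def\<close>)
  also have "\<dots> \<le> emeasure \<mu> (ball c (3 * r))"
  proof (rule emeasure_mono)
    show "(\<Union>(z, s)\<in>K. ball z s) \<subseteq> ball c (3 * r)" using sub3 unfolding K_def A_def by fast
  qed (auto simp: \<mu>_def)
  also have "\<dots> = (\<integral>\<^sup>+x\<in>ball c (3 * r). ennreal (\<beta> * \<bar>w x - a\<bar>) \<partial>lebesgue)"
    unfolding \<mu>_def by (subst emeasure_density) auto
  also have "\<dots> = ennreal (ball_avg (\<lambda>x. \<beta> * \<bar>w x - a\<bar>) c (3 * r)) * emeasure lebesgue (ball c (3 * r))"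
    by (rule ball_avg_eq_nn_integral) (use li r \<beta>0 in auto)
  also have "ball_avg (\<lambda>x. \<beta> * \<bar>w x - a\<bar>) c (3 * r) = \<beta> * mean_osc w c (3 * r)"
    unfolding mean_osc_def a_def by (simp add: ball_avg_cmult)
  also have "ennreal (\<beta> * mean_osc w c (3 * r)) * emeasure lebesgue (ball c (3 * r))
      = ennreal (\<beta> * mean_osc w c (3 * r) * 3 ^ DIM('a)) * emeasure lebesgue (ball c r)"
    unfolding emeasure_lebesgue_ball using r measure_lebesgue_ball_scale[of r 3 c c] \<beta>0
    by (simp add: ennreal_mult[symmetric] mean_osc_nonneg ac_simps del: measure_completion)
  \<comment> \<open>The factors 10^n of the dilated balls and 3^n of \<open>ball c (3 * r)\<close>
    give 30^n / L, at most 1/2.\<close>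
  also have "\<dots> \<le> ennreal ((1 / 2) ^ Suc k) * emeasure lebesgue (ball c r)"
  proof (intro mult_right_mono ennreal_leI)
    have "\<beta> * mean_osc w c (3 * r) * 3 ^ DIM('a) \<le> \<beta> * e * 3 ^ DIM('a)"
      using r \<beta>0 by (intro mult_right_mono mult_left_mono osc) auto
    also have "\<dots> = (1 / 2) ^ k * (30 ^ DIM('a) / L)"
      unfolding \<beta>_def using e by (simp add: power_mult_distrib[symmetric])
    also have "\<dots> \<le> (1 / 2) ^ k * (1 / 2)"
    proof (intro mult_left_mono)
      have "(30::real) ^ DIM('a) \<le> 90 ^ DIM('a)" by (intro power_mono) auto
      then show "30 ^ DIM('a) / L \<le> 1 / 2" by (simp add: L field_simps)
    qed auto
    finally show "\<beta> * mean_osc w c (3 * r) * 3 ^ DIM('a) \<le> (1 / 2) ^ Suc k" by simp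
  qed simp
  finally show ?case unfolding E_def a_def .
qed

text \<open>\<open>H\<close> counts the exceeded levels in steps of \<open>D = 2 * L * e\<close>;
  the geometric series bounds its mean by 2D, which is 8 * 90^n e. A majorant with values in
  \<open>ennreal\<close> also covers points where the local maximal function is infinite.\<close>

lemma maximal_upto_excess:
  fixes w :: "'a::euclidean_space \<Rightarrow> real"
  assumes w: "locally_integrable w" and w0: "\<And>x. w x \<ge> 0" and e: "e > 0"
    and osc: "\<And>z s. 0 < s \<Longrightarrow> s \<le> 3 * r \<Longrightarrow> mean_osc w z s \<le> e"
    and r: "0 < r"
  obtains H where "H \<in> borel_measurable lebesgue"
    "\<And>x. x \<in> ball c r \<Longrightarrow> maximal_upto w r x \<le> ennreal (ball_avg w c (3 * r)) + H x"
    "(\<integral>\<^sup>+x\<in>ball c r. H x \<partial>lebesgue) \<le> ennreal (8 * 90 ^ DIM('a) * e) * emeasure lebesgue (ball c r)"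
proof
  define L :: real where "L = 2 * 90 ^ DIM('a)"
  define a where "a = ball_avg w c (3 * r)"
  define D where "D = 2 * L * e"
  define E where "E k = {x \<in> ball c r. ennreal (a + D * real k) < maximal_upto w r x}" for k
  define H where "H x = (\<Sum>k. ennreal D * indicator (E k) x)" for x
  have D: "D > 0" unfolding D_def L_def using e by simp
  have a0: "a \<ge> 0" unfolding a_def by (rule ball_avg_nonneg[OF w0])
  have E_meas [measurable]: "E k \<in> sets lebesgue" for k unfolding E_def by measurable
  show [measurable]: "H \<in> borel_measurable lebesgue" unfolding H_def by measurable
  have "(\<integral>\<^sup>+x\<in>ball c r. H x \<partial>lebesgue) \<le> (\<integral>\<^sup>+x. H x \<partial>lebesgue)"
    by (intro nn_integral_mono) (auto simp: indicator_def)
  also have "\<dots> = (\<Sum>k. \<integral>\<^sup>+x. ennreal D * indicator (E k) x \<partial>lebesgue)"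
    unfolding H_def by (intro nn_integral_suminf) measurable
  also have "\<dots> = (\<Sum>k. ennreal D * emeasure lebesgue (E k))"
    by (simp add: nn_integral_cmult_indicator)
  also have "\<dots> \<le> (\<Sum>k. ennreal D * (ennreal ((1 / 2) ^ k) * emeasure lebesgue (ball c r)))"
    unfolding E_def a_def D_def
    by (intro suminf_le mult_left_mono maximal_upto_decay[OF w w0 e osc L_def r]) auto
  also have "\<dots> = (\<Sum>k. ennreal ((1 / 2) ^ k)) * (ennreal D * emeasure lebesgue (ball c r))"
    by (simp add: ennreal_suminf_multc[symmetric] ac_simps)
  also have "(\<Sum>k. ennreal ((1 / 2) ^ k)) = ennreal 2"
    using geometric_sums[of "1/2::real"] by (intro suminf_ennreal_eq) auto
  also have "ennreal 2 * (ennreal D * emeasure lebesgue (ball c r))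
      = ennreal (8 * 90 ^ DIM('a) * e) * emeasure lebesgue (ball c r)"
    using D unfolding D_def L_def
    by (subst mult.assoc[symmetric], subst ennreal_mult[symmetric]) (auto simp: ac_simps)
  finally show "(\<integral>\<^sup>+x\<in>ball c r. H x \<partial>lebesgue)
      \<le> ennreal (8 * 90 ^ DIM('a) * e) * emeasure lebesgue (ball c r)" .
  show "maximal_upto w r x \<le> ennreal (ball_avg w c (3 * r)) + H x" if x: "x \<in> ball c r" for x
  proof (rule ccontr)
    assume "\<not> ?thesis"
    then have gt: "ennreal a + H x < maximal_upto w r x" by (simp add: a_def)
    then have "H x \<noteq> \<infinity>" by (metis ennreal_add_eq_top infinity_ennreal_def not_top_less)
    then obtain h where h: "H x = ennreal h" "h \<ge> 0" by (cases "H x") auto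
    \<comment> \<open>An excess above \<open>h\<close> puts \<open>x\<close> into
      \<open>E 0\<close>, ..., \<open>E N\<close>, whence \<open>H x\<close> is at least D (N + 1),
      which exceeds \<open>h\<close>.\<close>
    define N where "N = nat \<lfloor>h / D\<rfloor>"
    have N: "D * real N \<le> h" "h < D * (real N + 1)"
    proof -
      have "real N = of_int \<lfloor>h / D\<rfloor>" unfolding N_def using h(2) D by simp
      then have "real N \<le> h / D" "h / D < real N + 1" by linarith+
      then show "D * real N \<le> h" "h < D * (real N + 1)" using D by (simp_all add: field_simps)
    qed
    have "x \<in> E k" if "k \<le> N" for k
    proof -
      have "D * real k \<le> D * real N" using that D by (intro mult_left_mono) auto
      then have "ennreal (a + D * real k) \<le> ennreal (a + h)" using N(1) by (intro ennreal_leI) simp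
      also have "\<dots> < maximal_upto w r x" using gt h a0 by (simp add: ennreal_plus)
      finally show ?thesis unfolding E_def using x by simp
    qed
    then have "(\<Sum>k<Suc N. ennreal D * indicator (E k) x) = (\<Sum>k<Suc N. ennreal D)"
      by (intro sum.cong) auto
    then have "(\<Sum>k<Suc N. ennreal D) \<le> H x"
      unfolding H_def by (metis sum_le_suminf summableI finite_lessThan zero_le)
    then have "ennreal (D * (real N + 1)) \<le> ennreal h"
      unfolding h(1) using D by (simp add: ennreal_of_nat_eq_real_of_nat ennreal_mult[symmetric] algebra_simps del: sum.lessThan_Suc)
    then show False using N(2) h(2) D by (subst (asm) ennreal_le_iff) auto
  qed
qed

subsection \<open>Mean oscillation of the maximal function\<close>

lemma maximal_eq:
  fixes f :: "'a::euclidean_space \<Rightarrow> 'b::euclidean_space"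
  assumes f: "locally_integrable f"
  shows "maximal f x =
    (SUP (z, s) \<in> {(z, s). 0 < s \<and> x \<in> ball z s}. ennreal (ball_avg (\<lambda>y. norm (f y)) z s))"
  unfolding maximal_def
proof (rule SUP_cong[OF refl], clarify)
  fix z :: 'a and s :: real assume s: "0 < s"
  have "(\<integral>\<^sup>+y\<in>ball z s. ennreal (norm (f y)) \<partial>lebesgue)
      = ennreal (ball_avg (\<lambda>y. norm (f y)) z s) * emeasure lebesgue (ball z s)"
    by (rule ball_avg_eq_nn_integral) (use s locally_integrable_norm[OF f] in auto)
  then show "(\<integral>\<^sup>+y\<in>ball z s. ennreal (norm (f y)) \<partial>lebesgue) / emeasure lebesgue (ball z s)
      = ennreal (ball_avg (\<lambda>y. norm (f y)) z s)"
    using measure_lebesgue_ball_pos[OF s, of z]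
    by (simp only:) (simp add: emeasure_lebesgue_ball ennreal_mult_divide_eq)
qed

lemma less_maximal_iff:
  fixes f :: "'a::euclidean_space \<Rightarrow> 'b::euclidean_space"
  assumes "locally_integrable f"
  shows "t < maximal f x \<longleftrightarrow>
     (\<exists>z s. 0 < s \<and> x \<in> ball z s \<and> t < ennreal (ball_avg (\<lambda>y. norm (f y)) z s))"
  unfolding maximal_eq[OF assms] by (auto simp: less_SUP_iff)

lemma ball_avg_le_maximal:
  fixes f :: "'a::euclidean_space \<Rightarrow> 'b::euclidean_space"
  assumes "locally_integrable f" "0 < s" "x \<in> ball z s"
  shows "ennreal (ball_avg (\<lambda>y. norm (f y)) z s) \<le> maximal f x"
  using less_maximal_iff[OF assms(1), of "maximal f x" x] assms(2,3) by (meson less_irrefl not_le)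

lemma borel_measurable_maximal [measurable]:
  fixes f :: "'a::euclidean_space \<Rightarrow> 'b::euclidean_space"
  assumes "locally_integrable f"
  shows "maximal f \<in> borel_measurable lebesgue"
proof (rule borel_measurableI_greater)
  fix t
  have "{x. t < maximal f x} =
      (\<Union>(z, s)\<in>{(z, s). 0 < s \<and> t < ennreal (ball_avg (\<lambda>y. norm (f y)) z s)}. ball z s)"
    by (auto simp: less_maximal_iff[OF assms]) blast+
  also have "open \<dots>" by (intro open_UN) auto
  finally show "{x \<in> space lebesgue. t < maximal f x} \<in> sets lebesgue"
    by (simp add: borel_open)
qed

text \<open>The two ranges of radii enter as hypotheses, through \<open>H\<close> up to
  \<open>r\<close> and through \<open>\<eta>\<close> beyond, because arbitrary balls, small balls,
  and large or distant balls supply them by different arguments. Nothing is assumed about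
  integrability of \<open>maximal f\<close>.\<close>

lemma maximal_excess:
  fixes f :: "'a::euclidean_space \<Rightarrow> 'b::euclidean_space"
  assumes f: "locally_integrable f" and r: "r > 0"
    and m: "m = (INF y\<in>ball c r. maximal f y)" "m \<noteq> \<infinity>"
    and H: "H \<in> borel_measurable lebesgue"
      "\<And>x. x \<in> ball c r \<Longrightarrow> maximal_upto (\<lambda>y. norm (f y)) r x \<le> m + H x"
      "(\<integral>\<^sup>+x\<in>ball c r. H x \<partial>lebesgue) \<le> ennreal \<alpha> * emeasure lebesgue (ball c r)"
    and far: "\<And>z s. r < s \<Longrightarrow> ball z s \<inter> ball c r \<noteq> {} \<Longrightarrow>
      ball_avg (\<lambda>y. norm (f y)) z s \<le> ball_avg (\<lambda>y. norm (f y)) z (s + 2 * r) + \<eta>"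
    and pos: "\<alpha> \<ge> 0" "\<eta> \<ge> 0"
  shows "(\<integral>\<^sup>+x\<in>ball c r. (maximal f x - m) \<partial>lebesgue)
      \<le> ennreal (\<alpha> + \<eta>) * emeasure lebesgue (ball c r)"
proof -
  note [measurable] = H(1)
  let ?w = "\<lambda>y. norm (f y)"
  have le: "maximal f x \<le> m + (ennreal \<eta> + H x)" if x: "x \<in> ball c r" for x
  proof (rule ccontr)
    assume "\<not> ?thesis"
    then have "m + (ennreal \<eta> + H x) < maximal f x" by simp
    then obtain z s where zs: "0 < s" "x \<in> ball z s" "m + (ennreal \<eta> + H x) < ennreal (ball_avg ?w z s)"
      unfolding less_maximal_iff[OF f] by blast
    show False
    proof (cases "s \<le> r")
      case True
      then have "m + (ennreal \<eta> + H x) < maximal_upto ?w r x"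
        using zs unfolding less_maximal_upto_iff by blast
      also have "\<dots> \<le> m + H x" by (rule H(2)[OF x])
      also have "\<dots> \<le> m + (ennreal \<eta> + H x)" by (intro add_left_mono) simp
      finally show False by simp
    next
      case False
      have sub: "y \<in> ball z (s + 2 * r)" if "y \<in> ball c r" for y
        using that x zs(2) dist_triangle[of z y x] dist_triangle[of x y c] by (simp add: dist_commute)
      have "ennreal (ball_avg ?w z s) \<le> ennreal (ball_avg ?w z (s + 2 * r) + \<eta>)"
        using False x zs(2) by (intro ennreal_leI far) auto
      also have "\<dots> = ennreal (ball_avg ?w z (s + 2 * r)) + ennreal \<eta>"
        using pos by (simp add: ball_avg_nonneg ennreal_plus)
      also have "ennreal (ball_avg ?w z (s + 2 * r)) \<le> m"
        unfolding m(1) using zs(1) r sub by (intro INF_greatest ball_avg_le_maximal f) auto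
      also have "m + ennreal \<eta> \<le> m + (ennreal \<eta> + H x)" by (intro add_left_mono) simp
      finally show False using zs(3) by simp
    qed
  qed
  have "(\<integral>\<^sup>+x\<in>ball c r. (maximal f x - m) \<partial>lebesgue)
      \<le> (\<integral>\<^sup>+x. H x * indicator (ball c r) x + ennreal \<eta> * indicator (ball c r) x \<partial>lebesgue)"
  proof (intro nn_integral_mono)
    fix x
    show "(maximal f x - m) * indicator (ball c r) x
        \<le> H x * indicator (ball c r) x + ennreal \<eta> * indicator (ball c r) x"
    proof (cases "x \<in> ball c r")
      case True
      then show ?thesis using le[OF True] m(2) by (simp add: ennreal_minus_le_iff add.commute)
    qed simp
  qed
  also have "\<dots> = (\<integral>\<^sup>+x\<in>ball c r. H x \<partial>lebesgue) + ennreal \<eta> * emeasure lebesgue (ball c r)"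
    by (subst nn_integral_add) (auto simp: nn_integral_cmult_indicator)
  also have "\<dots> \<le> ennreal \<alpha> * emeasure lebesgue (ball c r) + ennreal \<eta> * emeasure lebesgue (ball c r)"
    by (intro add_right_mono H(3))
  also have "\<dots> = ennreal (\<alpha> + \<eta>) * emeasure lebesgue (ball c r)"
    using pos by (simp add: distrib_right ennreal_plus)
  finally show ?thesis .
qed

text \<open>With the infimum as centre the deviation has a sign, so its integral is that of the
  excess; recentring gives the 2. The infimum is finite because a ball is not a null set. That is
  shown inside, hence the excess hypothesis conditional on
  \<open>m \<noteq> \<infinity>\<close>.\<close>

lemma maximal_mean_osc_le:
  fixes f :: "'a::euclidean_space \<Rightarrow> 'b::euclidean_space"
  assumes f: "locally_integrable f" and r: "r > 0"
    and fin: "AE x in lebesgue. maximal f x \<noteq> \<infinity>"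
    and F: "locally_integrable (\<lambda>x. enn2real (maximal f x))"
    and ex: "\<And>m. m = (INF y\<in>ball c r. maximal f y) \<Longrightarrow> m \<noteq> \<infinity> \<Longrightarrow>
      (\<integral>\<^sup>+x\<in>ball c r. (maximal f x - m) \<partial>lebesgue) \<le> ennreal \<gamma> * emeasure lebesgue (ball c r)"
    and pos: "\<gamma> \<ge> 0"
  shows "mean_osc (\<lambda>x. enn2real (maximal f x)) c r \<le> 2 * \<gamma>"
proof -
  define m where "m = (INF y\<in>ball c r. maximal f y)"
  have "m \<noteq> \<infinity>"
  proof
    assume "m = \<infinity>"
    then have top: "maximal f x = \<infinity>" if "x \<in> ball c r" for x
      using INF_lower[OF that, of "maximal f"] by (simp add: m_def top_unique)
    from fin obtain N where N: "N \<in> null_sets lebesgue" "{x. \<not> maximal f x \<noteq> \<infinity>} \<subseteq> N"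
      unfolding eventually_ae_filter by auto
    have "emeasure lebesgue (ball c r) \<le> emeasure lebesgue N"
      using top N by (intro emeasure_mono) auto
    also have "\<dots> = 0" using N(1) by auto
    finally show False
      using measure_lebesgue_ball_pos[OF r, of c] by (simp add: emeasure_lebesgue_ball)
  qed
  then obtain q where q: "m = ennreal q" "q \<ge> 0" by (cases m) auto
  let ?F = "\<lambda>x. enn2real (maximal f x)"
  have li: "locally_integrable (\<lambda>x. norm (?F x - q))"
    by (intro locally_integrable_norm locally_integrable_diff F locally_integrable_const)
  have "ennreal (ball_avg (\<lambda>x. norm (?F x - q)) c r) * emeasure lebesgue (ball c r)
      = (\<integral>\<^sup>+x\<in>ball c r. ennreal (norm (?F x - q)) \<partial>lebesgue)"
    by (rule ball_avg_eq_nn_integral[symmetric, OF li _ r]) simp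
  also have "\<dots> = (\<integral>\<^sup>+x\<in>ball c r. (maximal f x - m) \<partial>lebesgue)"
  proof (intro nn_integral_cong_AE)
    show "AE x in lebesgue. ennreal (norm (?F x - q)) * indicator (ball c r) x
        = (maximal f x - m) * indicator (ball c r) x"
      using fin
    proof eventually_elim
      case (elim x)
      show ?case
      proof (cases "x \<in> ball c r")
        case True
        have "m \<le> maximal f x" unfolding m_def using True by (rule INF_lower)
        moreover obtain p where p: "maximal f x = ennreal p" "p \<ge> 0" using elim by (cases "maximal f x") auto
        ultimately have "q \<le> p" using q by (simp add: ennreal_le_iff)
        then show ?thesis using p q True by (simp add: ennreal_minus)
      qed simp
    qed
  qed
  also have "\<dots> \<le> ennreal \<gamma> * emeasure lebesgue (ball c r)"
    by (rule ex[OF m_def \<open>m \<noteq> \<infinity>\<close>])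
  finally have "ball_avg (\<lambda>x. norm (?F x - q)) c r \<le> \<gamma>"
    using measure_lebesgue_ball_pos[OF r, of c] pos
    by (simp add: emeasure_lebesgue_ball ennreal_mult[symmetric] ball_avg_nonneg ennreal_le_iff
        del: measure_completion)
  then show ?thesis using mean_osc_le[OF F r, of c q] by simp
qed

text \<open>Here |f| has oscillation at most 2b. The local part contributes 16 * 90^n b. For s > r
  the enlarged radius is below 3s, which contributes 2 * 3^n b; together at most 18 * 90^n
  b.\<close>

lemma maximal_excess_bmo:
  fixes f :: "'a::euclidean_space \<Rightarrow> 'b::euclidean_space"
  assumes f: "locally_integrable f" and b: "b > 0"
    and osc: "\<And>c r. r > 0 \<Longrightarrow> mean_osc f c r \<le> b"
    and r: "r > 0" and m: "m = (INF y\<in>ball c r. maximal f y)" "m \<noteq> \<infinity>"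
  shows "(\<integral>\<^sup>+x\<in>ball c r. (maximal f x - m) \<partial>lebesgue)
      \<le> ennreal (18 * 90 ^ DIM('a) * b) * emeasure lebesgue (ball c r)"
proof -
  let ?w = "\<lambda>y. norm (f y)"
  have w: "locally_integrable ?w" by (rule locally_integrable_norm[OF f])
  have oscw: "mean_osc ?w z s \<le> 2 * b" if "0 < s" for z s
    using mean_osc_norm_le[OF f that, of z] osc[OF that, of z] by simp
  obtain H where H: "H \<in> borel_measurable lebesgue"
    "\<And>x. x \<in> ball c r \<Longrightarrow> maximal_upto ?w r x \<le> ennreal (ball_avg ?w c (3 * r)) + H x"
    "(\<integral>\<^sup>+x\<in>ball c r. H x \<partial>lebesgue) \<le> ennreal (8 * 90 ^ DIM('a) * (2 * b)) * emeasure lebesgue (ball c r)"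
    by (rule maximal_upto_excess[OF w _ _ oscw r, of c]) (use b in auto)
  have avg: "ennreal (ball_avg ?w c (3 * r)) \<le> m"
    unfolding m(1) using r by (intro INF_greatest ball_avg_le_maximal f) auto
  have "(\<integral>\<^sup>+x\<in>ball c r. (maximal f x - m) \<partial>lebesgue)
      \<le> ennreal (8 * 90 ^ DIM('a) * (2 * b) + 3 ^ DIM('a) * (2 * b)) * emeasure lebesgue (ball c r)"
  proof (rule maximal_excess[OF f r m H(1) _ H(3)])
    show "maximal_upto ?w r x \<le> m + H x" if "x \<in> ball c r" for x
      using H(2)[OF that] avg by (meson add_right_mono order_trans)
    fix z s assume s: "r < s"
    have "\<bar>ball_avg ?w z s - ball_avg ?w z (s + 2 * r)\<bar> \<le> 3 ^ DIM('a) * mean_osc ?w z (s + 2 * r)"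
      using s r by (intro ball_avg_nested_le w subset_ball) auto
    also have "\<dots> \<le> 3 ^ DIM('a) * (2 * b)" using s r by (intro mult_left_mono oscw) auto
    finally show "ball_avg ?w z s \<le> ball_avg ?w z (s + 2 * r) + 3 ^ DIM('a) * (2 * b)" by linarith
  qed (use b in auto)
  also have "\<dots> \<le> ennreal (18 * 90 ^ DIM('a) * b) * emeasure lebesgue (ball c r)"
  proof (intro mult_right_mono ennreal_leI)
    have "3 ^ DIM('a) * (2 * b) \<le> 90 ^ DIM('a) * (2 * b)" using b by (intro mult_right_mono power_mono) auto
    then show "8 * 90 ^ DIM('a) * (2 * b) + 3 ^ DIM('a) * (2 * b) \<le> 18 * 90 ^ DIM('a) * b"
      by (simp add: ac_simps)
  qed simp
  finally show ?thesis .
qed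

text \<open>On a ball around \<open>x0\<close> the infimum is at most \<open>maximal f x0\<close>,
  hence finite; adding it to the bounded excess shows that the integral of \<open>maximal f\<close>
  over the ball is finite.\<close>

lemma maximal_locally_finite:
  fixes f :: "'a::euclidean_space \<Rightarrow> 'b::euclidean_space"
  assumes f: "locally_integrable f" and b: "b > 0"
    and osc: "\<And>c r. r > 0 \<Longrightarrow> mean_osc f c r \<le> b"
    and x0: "maximal f x0 \<noteq> \<infinity>"
  shows "AE x in lebesgue. maximal f x \<noteq> \<infinity>"
    and "locally_integrable (\<lambda>x. enn2real (maximal f x))"
proof -
  note [measurable] = borel_measurable_maximal[OF f]
  have fin: "(\<integral>\<^sup>+x\<in>ball 0 r. maximal f x \<partial>lebesgue) < \<infinity>" if r: "r > norm x0" for r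
  proof -
    define m where "m = (INF y\<in>ball 0 r. maximal f y)"
    have r0: "r > 0" using r norm_ge_zero[of x0] by linarith
    have mx: "m \<le> maximal f x" if "x \<in> ball 0 r" for x unfolding m_def using that by (rule INF_lower)
    have "m \<noteq> \<infinity>" using mx[of x0] x0 r by (auto simp: top_unique)
    have "(\<integral>\<^sup>+x\<in>ball 0 r. maximal f x \<partial>lebesgue)
        = (\<integral>\<^sup>+x. (maximal f x - m) * indicator (ball 0 r) x + m * indicator (ball 0 r) x \<partial>lebesgue)"
      using mx by (intro nn_integral_cong) (auto simp: indicator_def diff_add_cancel_ennreal)
    also have "\<dots> = (\<integral>\<^sup>+x\<in>ball 0 r. (maximal f x - m) \<partial>lebesgue) + m * emeasure lebesgue (ball (0::'a) r)"
      by (subst nn_integral_add) (auto simp: nn_integral_cmult_indicator)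
    also have "\<dots> \<le> ennreal (18 * 90 ^ DIM('a) * b) * emeasure lebesgue (ball (0::'a) r)
        + m * emeasure lebesgue (ball (0::'a) r)"
      by (intro add_right_mono maximal_excess_bmo[OF f b osc r0 m_def \<open>m \<noteq> \<infinity>\<close>])
    also have "\<dots> < \<infinity>"
      using \<open>m \<noteq> \<infinity>\<close> by (simp add: emeasure_lebesgue_ball ennreal_mult_less_top less_top[symmetric] ennreal_mult_eq_top_iff)
    finally show ?thesis .
  qed
  have ae: "AE x in lebesgue. x \<in> ball 0 r \<longrightarrow> maximal f x \<noteq> \<infinity>" if r: "r > norm x0" for r
  proof -
    have "AE x in lebesgue. maximal f x * indicator (ball 0 r) x \<noteq> \<infinity>"
      using fin[OF r] by (intro nn_integral_PInf_AE) auto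
    then show ?thesis by eventually_elim auto
  qed
  have "AE x in lebesgue. \<forall>n::nat. x \<in> ball 0 (norm x0 + 1 + real n) \<longrightarrow> maximal f x \<noteq> \<infinity>"
    unfolding AE_all_countable by (intro allI ae) simp
  then show "AE x in lebesgue. maximal f x \<noteq> \<infinity>"
  proof eventually_elim
    case (elim x)
    obtain n where "norm x < real n" using reals_Archimedean2 by blast
    then show ?case using elim[rule_format, of n] by (simp add: add_strict_increasing2)
  qed
  show "locally_integrable (\<lambda>x. enn2real (maximal f x))"
  proof (rule locally_integrableI_cball)
    fix r :: real assume "r > 0"
    let ?B = "ball (0::'a) (norm x0 + r + 1)"
    have "set_integrable lebesgue ?B (\<lambda>x. enn2real (maximal f x))"
      unfolding set_integrable_def
    proof (rule integrableI_bounded)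
      have "(\<integral>\<^sup>+x. ennreal (norm (indicat_real ?B x *\<^sub>R enn2real (maximal f x))) \<partial>lebesgue)
          \<le> (\<integral>\<^sup>+x\<in>?B. maximal f x \<partial>lebesgue)"
      proof (intro nn_integral_mono)
        fix x
        show "ennreal (norm (indicat_real ?B x *\<^sub>R enn2real (maximal f x))) \<le> maximal f x * indicator ?B x"
        proof (cases "x \<in> ?B")
          case True
          then show ?thesis by (cases "maximal f x") auto
        qed simp
      qed
      also have "\<dots> < \<infinity>" using \<open>r > 0\<close> by (intro fin) simp
      finally show "(\<integral>\<^sup>+x. ennreal (norm (indicat_real ?B x *\<^sub>R enn2real (maximal f x))) \<partial>lebesgue) < \<infinity>" .
    qed measurable
    moreover have "cball (0::'a) r \<in> sets lebesgue" by (simp add: borel_closed)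
    moreover have "cball 0 r \<subseteq> ?B"
    proof
      fix x :: 'a assume "x \<in> cball 0 r"
      then have "norm x < norm x0 + r + 1" using norm_ge_zero[of x0] unfolding mem_cball_0 by linarith
      then show "x \<in> ?B" by simp
    qed
    ultimately show "set_integrable lebesgue (cball 0 r) (\<lambda>x. enn2real (maximal f x))"
      by (rule set_integrable_subset)
  qed
qed

section \<open>Excess over small balls\<close>

lemma maximal_excess_osc_small:
  fixes f g :: "'a::euclidean_space \<Rightarrow> 'b::euclidean_space"
  assumes f: "locally_integrable f" and g: "continuous_on UNIV g" and e: "e > 0"
    and h: "\<And>c r. r > 0 \<Longrightarrow> mean_osc (\<lambda>x. f x - g x) c r \<le> e"
    and G: "G > 0" "\<And>x. norm (g x) \<le> G"
    and d: "d > 0" "\<And>x y. dist x y < d \<Longrightarrow> norm (g x - g y) \<le> e"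
  obtains \<delta> where "\<delta> > 0"
    "\<And>c r m. 0 < r \<Longrightarrow> r \<le> \<delta> \<Longrightarrow> m = (INF y\<in>ball c r. maximal f y) \<Longrightarrow> m \<noteq> \<infinity> \<Longrightarrow>
      (\<integral>\<^sup>+x\<in>ball c r. (maximal f x - m) \<partial>lebesgue)
        \<le> ennreal (54 * 90 ^ DIM('a) * e) * emeasure lebesgue (ball c r)"
proof -
  let ?w = "\<lambda>y. norm (f y)" and ?h = "\<lambda>x. f x - g x" and ?n = "DIM('a)"
  have gl: "locally_integrable g" by (rule locally_integrable_continuous[OF g])
  have w: "locally_integrable ?w" by (rule locally_integrable_norm[OF f])
  have hl: "locally_integrable ?h" by (rule locally_integrable_diff[OF f gl])
  \<comment> \<open>Up to scale \<open>d\<close> the oscillation of g is at most 2e, that of f at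
    most 3e, and passing to |f| doubles it.\<close>
  have oscw: "mean_osc ?w z s \<le> 6 * e" if s: "0 < s" "s \<le> d" for z s
  proof -
    have "mean_osc g z s \<le> 2 * ball_avg (\<lambda>x. norm (g x - g z)) z s"
      by (rule mean_osc_le[OF gl s(1)])
    also have "\<dots> \<le> 2 * ball_avg (\<lambda>x. e) z s"
      using s(2) d(2)
      by (intro mult_left_mono ball_avg_mono_on locally_integrable_norm locally_integrable_diff gl
          locally_integrable_const) (auto simp: dist_commute)
    also have "\<dots> = 2 * e" using s(1) by (simp add: ball_avg_const)
    finally have "mean_osc g z s \<le> 2 * e" .
    moreover have "mean_osc f z s \<le> mean_osc ?h z s + mean_osc g z s"
      using mean_osc_add_le[OF hl gl, of z s] by simp
    ultimately show ?thesis using mean_osc_norm_le[OF f s(1), of z] h[OF s(1), of z] by simp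
  qed
  have "((\<lambda>x::real. (1 + x) ^ ?n) \<longlongrightarrow> (1 + 0) ^ ?n) (at_right 0)" by (intro tendsto_intros)
  \<comment> \<open>A volume ratio of at most 1 + e / (2G) lets the term 2G of the auxiliary
    function below grow by at most e.\<close>
  then have "eventually (\<lambda>x::real. (1 + x) ^ ?n < 1 + e / (2 * G)) (at_right 0)"
    using e G(1) by (intro order_tendstoD(2)) auto
  then obtain b where b: "b > 0" "\<And>x. 0 < x \<Longrightarrow> x < b \<Longrightarrow> (1 + x) ^ ?n < 1 + e / (2 * G)"
    unfolding eventually_at_right_field by auto
  define \<tau> where "\<tau> = b / 2"
  have \<tau>: "\<tau> > 0" "(1 + \<tau>) ^ ?n \<le> 1 + e / (2 * G)" unfolding \<tau>_def using b(1) b(2)[of "b / 2"] by auto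
  \<comment> \<open>The first entry keeps \<open>3 * r\<close> below \<open>d\<close> for the
    stopping-time argument and makes \<open>s\<close> at least d/3 once s + 2r > d. The second then
    gives 2r <= \<open>\<tau>\<close> s, so the ratio of radii is at most 1 +
    \<open>\<tau>\<close>.\<close>
  define \<delta> where "\<delta> = min (d / 9) (\<tau> * d / 6)"
  show ?thesis
  proof (rule that[of \<delta>])
    show "\<delta> > 0" unfolding \<delta>_def using d \<tau> by simp
    fix c :: 'a and r m
    assume r: "0 < r" "r \<le> \<delta>" and m: "m = (INF y\<in>ball c r. maximal f y)" "m \<noteq> \<infinity>"
    have rd: "9 * r \<le> d" "6 * r \<le> \<tau> * d" using r(2) unfolding \<delta>_def by auto
    obtain H where H: "H \<in> borel_measurable lebesgue"
      "\<And>x. x \<in> ball c r \<Longrightarrow> maximal_upto ?w r x \<le> ennreal (ball_avg ?w c (3 * r)) + H x"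
      "(\<integral>\<^sup>+x\<in>ball c r. H x \<partial>lebesgue) \<le> ennreal (8 * 90 ^ ?n * (6 * e)) * emeasure lebesgue (ball c r)"
      by (rule maximal_upto_excess[OF w _ _ oscw r(1), of c]) (use e rd r in auto)
    have avg: "ennreal (ball_avg ?w c (3 * r)) \<le> m"
      unfolding m(1) using r by (intro INF_greatest ball_avg_le_maximal f) auto
    have "(\<integral>\<^sup>+x\<in>ball c r. (maximal f x - m) \<partial>lebesgue)
        \<le> ennreal (8 * 90 ^ ?n * (6 * e) + 3 ^ ?n * (6 * e)) * emeasure lebesgue (ball c r)"
    proof (rule maximal_excess[OF f r(1) m H(1) _ H(3)])
      show "maximal_upto ?w r x \<le> m + H x" if "x \<in> ball c r" for x
        using H(2)[OF that] avg by (meson add_right_mono order_trans)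
      fix z s assume s: "r < s"
      define t where "t = s + 2 * r"
      have t: "0 < t" "s \<le> t" "t \<le> 3 * s" unfolding t_def using s r by auto
      show "ball_avg ?w z s \<le> ball_avg ?w z (s + 2 * r) + 3 ^ ?n * (6 * e)"
      proof (cases "t \<le> d")
        case True
        have "\<bar>ball_avg ?w z s - ball_avg ?w z t\<bar> \<le> 3 ^ ?n * mean_osc ?w z t"
          using s r t by (intro ball_avg_nested_le w subset_ball) auto
        also have "\<dots> \<le> 3 ^ ?n * (6 * e)" using t True by (intro mult_left_mono oscw) auto
        finally show ?thesis unfolding t_def by linarith
      next
        case False
        define a where "a = ball_avg ?w z t"
        define hA where "hA = ball_avg ?h z t"
        (* Oscillation of w over the ball is not small here. But w - a + \<phi> is nonnegative and the
           radii are nearly equal, so comparing its means over the two balls costs only the factor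
           k ^ n, which is close to 1. *)
        define \<phi> where "\<phi> y = norm (?h y - hA) + (e + 2 * G)" for y
        have n1: "locally_integrable (\<lambda>y. norm (?h y - hA))"
          by (intro locally_integrable_norm locally_integrable_diff hl locally_integrable_const)
        have \<phi>l: "locally_integrable \<phi>"
          unfolding \<phi>_def by (intro locally_integrable_add n1 locally_integrable_const)
        have avg\<phi>: "ball_avg \<phi> z q = ball_avg (\<lambda>y. norm (?h y - hA)) z q + (e + 2 * G)" if "q > 0" for q
          unfolding \<phi>_def using that by (simp add: ball_avg_add[OF n1 locally_integrable_const] ball_avg_const)
        \<comment> \<open>Average |f(u) - f(y)| over u after splitting f into g and h and inserting
          the mean of h: g contributes 2G, and h its deviation at y plus its mean oscillation, at
          most e.\<close>
        have dev: "\<bar>?w y - a\<bar> \<le> \<phi> y" for y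
        proof -
          have n2: "locally_integrable (\<lambda>u. norm (?h u - hA) + (norm (?h y - hA) + 2 * G))"
            by (intro locally_integrable_add n1 locally_integrable_const)
          have "\<bar>?w y - a\<bar> \<le> ball_avg (\<lambda>u. norm (?w u - ?w y)) z t"
            using norm_ball_avg_diff_le[OF w t(1), of z "?w y"] by (simp add: a_def abs_minus_commute)
          also have "\<dots> \<le> ball_avg (\<lambda>u. norm (?h u - hA) + (norm (?h y - hA) + 2 * G)) z t"
          proof (intro ball_avg_mono n2 locally_integrable_norm[OF locally_integrable_diff[OF w locally_integrable_const]])
            fix u
            have "norm (?w u - ?w y) \<le> norm (f u - f y)" by (simp add: norm_triangle_ineq3)
            also have "f u - f y = (?h u - hA) - (?h y - hA) + (g u - g y)" by simp
            also have "norm \<dots> \<le> norm (?h u - hA) + norm (?h y - hA) + (norm (g u) + norm (g y))"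
              by (intro norm_triangle_le add_mono norm_triangle_ineq4)
            also have "\<dots> \<le> norm (?h u - hA) + (norm (?h y - hA) + 2 * G)"
              using G(2)[of u] G(2)[of y] by simp
            finally show "norm (?w u - ?w y) \<le> norm (?h u - hA) + (norm (?h y - hA) + 2 * G)" .
          qed
          also have "\<dots> = mean_osc ?h z t + (norm (?h y - hA) + 2 * G)"
            unfolding mean_osc_def hA_def[symmetric] using t(1)
            by (simp add: ball_avg_add[OF n1 locally_integrable_const] ball_avg_const)
          also have "\<dots> \<le> \<phi> y" using h[OF t(1), of z] by (simp add: \<phi>_def)
          finally show ?thesis .
        qed
        define k where "k = t / s"
        have k: "k > 0" "k \<le> 3" "t = k * s" using s r t by (auto simp: k_def field_simps)
        have k1: "k ^ ?n \<le> 1 + e / (2 * G)"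
        proof -
          have "3 * s \<ge> d" using False rd(1) r(1) unfolding t_def by linarith
          then have "\<tau> * d \<le> \<tau> * (3 * s)" using \<tau>(1) by (intro mult_left_mono) auto
          then have "2 * r \<le> \<tau> * s" using rd(2) by linarith
          then have "k \<le> 1 + \<tau>" using s r(1) by (simp add: k_def t_def field_simps)
          then have "k ^ ?n \<le> (1 + \<tau>) ^ ?n" using k(1) by (intro power_mono) auto
          then show ?thesis using \<tau>(2) by simp
        qed
        have k3: "k ^ ?n \<le> 3 ^ ?n" using k by (intro power_mono) auto
        have ul: "locally_integrable (\<lambda>y. ?w y - a + \<phi> y)"
          by (intro locally_integrable_add locally_integrable_diff w locally_integrable_const \<phi>l)
        have avgu: "ball_avg (\<lambda>y. ?w y - a + \<phi> y) z q = ball_avg ?w z q - a + ball_avg \<phi> z q" if "q > 0" for q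
          using that
          by (simp add: ball_avg_add[OF locally_integrable_diff[OF w locally_integrable_const] \<phi>l]
              ball_avg_diff[OF w locally_integrable_const] ball_avg_const)
        have "ball_avg (\<lambda>y. ?w y - a + \<phi> y) z s \<le> k ^ ?n * ball_avg (\<lambda>y. ?w y - a + \<phi> y) z t"
        proof (intro ball_avg_subset ul)
          show "0 \<le> ?w y - a + \<phi> y" for y using dev[of y] by linarith
          show "ball z s \<subseteq> ball z t" by (rule subset_ball[OF t(2)])
        qed (use s r k in auto)
        \<comment> \<open>Over the larger ball w - a has mean 0, so only \<open>\<phi>\<close>
          remains on the right. Its means are at least e + 2G on the left and at most 2e + 2G on the
          right; as k^n 2G <= 2G + e, the large terms cancel and 3^n 2e is left.\<close>
        then have "ball_avg ?w z s - a + ball_avg \<phi> z s \<le> k ^ ?n * ball_avg \<phi> z t"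
          using s r t by (simp add: avgu a_def[symmetric])
        moreover have "ball_avg \<phi> z s \<ge> e + 2 * G"
          using s r by (simp add: avg\<phi> ball_avg_nonneg)
        moreover have "ball_avg \<phi> z t \<le> 2 * e + 2 * G"
          using avg\<phi>[OF t(1)] h[OF t(1), of z] unfolding mean_osc_def hA_def[symmetric] by simp
        then have "k ^ ?n * ball_avg \<phi> z t \<le> k ^ ?n * (2 * e + 2 * G)"
          using k(1) by (intro mult_left_mono) auto
        moreover have "k ^ ?n * (2 * e + 2 * G) \<le> 3 ^ ?n * (2 * e) + (2 * G + e)"
        proof -
          have "k ^ ?n * (2 * G) \<le> (1 + e / (2 * G)) * (2 * G)" using k1 G(1) by (intro mult_right_mono) auto
          also have "\<dots> = 2 * G + e" using G(1) by (simp add: field_simps)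
          finally have "k ^ ?n * (2 * G) \<le> 2 * G + e" .
          moreover have "k ^ ?n * (2 * e) \<le> 3 ^ ?n * (2 * e)" using k3 e by (intro mult_right_mono) auto
          ultimately show ?thesis by (simp add: distrib_left)
        qed
        moreover have "3 ^ ?n * (2 * e) \<le> 3 ^ ?n * (6 * e)" using e by (intro mult_left_mono) auto
        ultimately have "ball_avg ?w z s \<le> a + 3 ^ ?n * (6 * e)" by linarith
        then show ?thesis by (simp add: a_def t_def)
      qed
    qed (use e in auto)
    \<comment> \<open>48 = 8 * 6 from the local part with oscillation 6e, and 6 from the enlarged
      balls.\<close>
    also have "\<dots> \<le> ennreal (54 * 90 ^ ?n * e) * emeasure lebesgue (ball c r)"
    proof (intro mult_right_mono ennreal_leI)
      have "3 ^ ?n * (6 * e) \<le> 90 ^ ?n * (6 * e)" using e by (intro mult_right_mono power_mono) auto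
      then show "8 * 90 ^ ?n * (6 * e) + 3 ^ ?n * (6 * e) \<le> 54 * 90 ^ ?n * e" by (simp add: ac_simps)
    qed simp
    finally show "(\<integral>\<^sup>+x\<in>ball c r. (maximal f x - m) \<partial>lebesgue)
        \<le> ennreal (54 * 90 ^ ?n * e) * emeasure lebesgue (ball c r)" .
  qed
qed

section \<open>Excess over large or distant balls\<close>

lemma ball_avg_compact_support_small:
  fixes u :: "'a::euclidean_space \<Rightarrow> real"
  assumes u: "locally_integrable u" "\<And>x. 0 \<le> u x" "\<And>x. u x \<le> G"
    and S: "S > 0" "\<And>x. x \<notin> ball 0 S \<Longrightarrow> u x = 0" and e: "e > 0" and G: "G > 0"
  obtains R where "R > 0" "\<And>(z::'a) s. R \<le> s \<Longrightarrow> G * measure lebesgue (ball (0::'a) S) \<le> e * measure lebesgue (ball z s)"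
    "\<And>z s. R \<le> s \<Longrightarrow> ball_avg u z s \<le> e"
proof -
  \<comment> \<open>Scaling the radius S by q = max 1 (G / e) multiplies volume by q^n >= q. Hence
    the mass of u, at most G times the volume of \<open>ball 0 S\<close>, is at most e times the
    volume of any ball of radius at least R.\<close>
  define R where "R = S * max 1 (G / e)"
  have R: "R > 0" unfolding R_def using S(1) by simp
  have V: "G * measure lebesgue (ball (0::'a) S) \<le> e * measure lebesgue (ball z s)" if s: "R \<le> s" for z :: 'a and s
  proof -
    have "G / e \<le> max 1 (G / e) ^ 1" by simp
    also have "\<dots> \<le> max 1 (G / e) ^ DIM('a)" by (intro power_increasing) (auto simp: Suc_leI)
    finally have "G \<le> e * max 1 (G / e) ^ DIM('a)" using e by (simp add: field_simps)
    then have "G * measure lebesgue (ball (0::'a) S) \<le> e * max 1 (G / e) ^ DIM('a) * measure lebesgue (ball (0::'a) S)"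
      by (intro mult_right_mono) auto
    also have "\<dots> = e * measure lebesgue (ball z (max 1 (G / e) * S))"
      using measure_lebesgue_ball_scale[of S "max 1 (G / e)" z 0] S(1) by simp
    also have "\<dots> \<le> e * measure lebesgue (ball z s)"
      using s e by (intro mult_left_mono measure_mono_fmeasurable subset_ball) (auto simp: R_def mult.commute)
    finally show ?thesis .
  qed
  have avg: "ball_avg u z s \<le> e" if s: "R \<le> s" for z s
  proof -
    have s0: "s > 0" using s R by simp
    have "ennreal (ball_avg u z s) * emeasure lebesgue (ball z s) = (\<integral>\<^sup>+x\<in>ball z s. ennreal (u x) \<partial>lebesgue)"
      by (rule ball_avg_eq_nn_integral[symmetric]) (use u s0 in auto)
    also have "\<dots> \<le> (\<integral>\<^sup>+(x::'a). ennreal G * indicator (ball 0 S) x \<partial>lebesgue)"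
    proof (intro nn_integral_mono)
      fix x
      show "ennreal (u x) * indicator (ball z s) x \<le> ennreal G * indicator (ball 0 S) x"
        using u(3)[of x] S(2)[of x] by (auto simp: indicator_def ennreal_leI)
    qed
    also have "\<dots> = ennreal (G * measure lebesgue (ball (0::'a) S))"
      using G by (simp add: nn_integral_cmult_indicator emeasure_lebesgue_ball ennreal_mult del: measure_completion)
    also have "\<dots> \<le> ennreal (e * measure lebesgue (ball z s))" by (intro ennreal_leI V s)
    finally show ?thesis
      using e measure_lebesgue_ball_pos[OF s0, of z]
      by (simp add: emeasure_lebesgue_ball ennreal_mult[symmetric] ball_avg_nonneg u(2) ennreal_le_iff
          del: measure_completion)
  qed
  show ?thesis by (rule that[OF R V avg])
qed

lemma maximal_upto_add_le:
  fixes u v :: "'a::euclidean_space \<Rightarrow> real"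
  assumes w: "locally_integrable w" and u: "locally_integrable u" and v: "locally_integrable v"
    and "\<And>x. w x \<le> u x + v x" "\<And>x. 0 \<le> u x" "\<And>x. 0 \<le> v x"
  shows "maximal_upto w r x \<le> maximal_upto u r x + maximal_upto v r x"
  unfolding maximal_upto_def[of w]
proof (rule SUP_least, clarify)
  fix z s assume zs: "0 < s" "s \<le> r" "x \<in> ball z s"
  have "ball_avg w z s \<le> ball_avg u z s + ball_avg v z s"
    unfolding ball_avg_add[OF u v, symmetric] using assms by (intro ball_avg_mono locally_integrable_add) auto
  then have "ennreal (ball_avg w z s) \<le> ennreal (ball_avg u z s) + ennreal (ball_avg v z s)"
    using assms by (simp add: ennreal_plus[symmetric] ball_avg_nonneg ennreal_leI del: ennreal_plus)
  also have "\<dots> \<le> maximal_upto u r x + maximal_upto v r x"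
    unfolding maximal_upto_def using zs by (intro add_mono SUP_upper2[of "(z, s)"]) auto
  finally show "ennreal (ball_avg w z s) \<le> maximal_upto u r x + maximal_upto v r x" .
qed

text \<open>Below scale \<open>r\<close> g may oscillate, so the decay is applied to |f - g|. The
  local maximal function of |g| is at most e off a fixed ball and at most e + G on it, and that ball
  is either disjoint from \<open>ball c r\<close> or of small relative measure.\<close>

lemma maximal_excess_far:
  fixes f g :: "'a::euclidean_space \<Rightarrow> 'b::euclidean_space"
  assumes f: "locally_integrable f" and g: "continuous_on UNIV g" and e: "e > 0"
    and h: "\<And>c r. r > 0 \<Longrightarrow> mean_osc (\<lambda>x. f x - g x) c r \<le> e"
    and G: "G > 0" "\<And>x. norm (g x) \<le> G"
    and S: "S > 0" "\<And>x. x \<notin> ball 0 S \<Longrightarrow> g x = 0"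
  obtains R where "R > 0"
    "\<And>c r m. 0 < r \<Longrightarrow> R \<le> r \<or> R \<le> norm c \<Longrightarrow> m = (INF y\<in>ball c r. maximal f y) \<Longrightarrow> m \<noteq> \<infinity> \<Longrightarrow>
      (\<integral>\<^sup>+x\<in>ball c r. (maximal f x - m) \<partial>lebesgue)
        \<le> ennreal (54 * 90 ^ DIM('a) * e) * emeasure lebesgue (ball c r)"
proof -
  let ?w = "\<lambda>y. norm (f y)" and ?h = "\<lambda>x. f x - g x" and ?n = "DIM('a)"
  let ?u = "\<lambda>y. norm (g y)" and ?v = "\<lambda>y. norm (f y - g y)"
  have gl: "locally_integrable g" by (rule locally_integrable_continuous[OF g])
  have w: "locally_integrable ?w" by (rule locally_integrable_norm[OF f])
  have hl: "locally_integrable ?h" by (rule locally_integrable_diff[OF f gl])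
  have u: "locally_integrable ?u" by (rule locally_integrable_norm[OF gl])
  have v: "locally_integrable ?v" by (rule locally_integrable_norm[OF hl])
  have wuv: "?w x \<le> ?v x + ?u x" for x using norm_triangle_ineq[of "f x - g x" "g x"] by simp
  have vwu: "?v x \<le> ?w x + ?u x" for x by (rule norm_triangle_ineq4)
  obtain R0 where R0: "R0 > 0" "\<And>z s. R0 \<le> s \<Longrightarrow> ball_avg ?u z s \<le> e"
    by (rule ball_avg_compact_support_small[of ?u G S e]) (use u G S e in auto)
  have avg0: "ball_avg ?u z s \<le> e" if "s > 0" "ball z s \<inter> ball 0 S = {}" for z s
  proof -
    have "norm (g x) \<le> 0" if "x \<in> ball z s" for x
      using S(2)[of x] that \<open>ball z s \<inter> ball 0 S = {}\<close> by (simp add: disjoint_iff)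
    then have "ball_avg ?u z s \<le> ball_avg (\<lambda>x. 0) z s"
      by (intro ball_avg_mono_on u locally_integrable_const)
    then show ?thesis using that(1) e by (simp add: ball_avg_const)
  qed
  \<comment> \<open>A ball of radius below \<open>R0\<close> through a point outside
    \<open>ball 0 \<rho>\<close> misses \<open>ball 0 S\<close>; larger balls have small mean
    anyway. This is why the averaging lemma is used a second time, with \<open>\<rho>\<close> in
    place of \<open>S\<close>.\<close>
  define \<rho> where "\<rho> = S + 2 * R0"
  have \<rho>: "\<rho> > 0" "S \<le> \<rho>" unfolding \<rho>_def using S R0 by auto
  obtain R1 where R1: "R1 > 0" "\<And>(z::'a) s. R1 \<le> s \<Longrightarrow>
      G * measure lebesgue (ball (0::'a) \<rho>) \<le> e * measure lebesgue (ball z s)"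
    "\<And>z s. R1 \<le> s \<Longrightarrow> ball_avg ?u z s \<le> e"
    by (rule ball_avg_compact_support_small[of ?u G \<rho> e]) (use u G S e \<rho> in auto)
  have Mu: "maximal_upto ?u r x \<le> ennreal e + ennreal G * indicator (ball 0 \<rho>) x" for r x
    unfolding maximal_upto_def
  proof (rule SUP_least, clarify)
    fix z s assume zs: "0 < s" "s \<le> r" "x \<in> ball z s"
    show "ennreal (ball_avg ?u z s) \<le> ennreal e + ennreal G * indicator (ball 0 \<rho>) x"
    proof (cases "x \<in> ball 0 \<rho>")
      case True
      have "ball_avg ?u z s \<le> ball_avg (\<lambda>x. G) z s"
        using G by (intro ball_avg_mono u locally_integrable_const) auto
      then have "ennreal (ball_avg ?u z s) \<le> ennreal G" using zs by (simp add: ball_avg_const ennreal_leI)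
      then show ?thesis using True by (simp add: add_increasing)
    next
      case False
      have "ball_avg ?u z s \<le> e"
      proof (cases "R0 \<le> s")
        case True then show ?thesis by (rule R0)
      next
        case s: False
        have "y \<notin> ball 0 S" if "y \<in> ball z s" for y
          using that zs s False norm_triangle_sub[of x y] dist_triangle[of x y z]
          by (auto simp: \<rho>_def dist_norm norm_minus_commute)
        then have "ball z s \<inter> ball 0 S = {}" by blast
        then show ?thesis using zs by (intro avg0) auto
      qed
      then show ?thesis using False by (simp add: ennreal_leI)
    qed
  qed
  \<comment> \<open>If \<open>r\<close> is below \<open>R1\<close>, then \<open>norm c\<close> is at
    least \<open>R\<close>, and the term 3 R1 keeps \<open>ball c (3 * r)\<close> outside
    \<open>ball 0 \<rho>\<close>. The term 3 R0 does the same for enlarged balls of radius below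
    \<open>R0\<close>.\<close>
  define R where "R = \<rho> + 3 * (R0 + R1)"
  show ?thesis
  proof (rule that[of R])
    show "R > 0" unfolding R_def using \<rho> R0 R1 by simp
    fix c :: 'a and r m
    assume r: "0 < r" "R \<le> r \<or> R \<le> norm c" and m: "m = (INF y\<in>ball c r. maximal f y)" "m \<noteq> \<infinity>"
    have far_ball: "y \<notin> ball 0 \<rho>" if "R1 > r" "y \<in> ball c (3 * r)" for y
    proof -
      have "R \<le> norm c" using r(2) that(1) \<rho> R0 R1 unfolding R_def by auto
      then show ?thesis using that norm_triangle_sub[of c y] R0(1) by (auto simp: R_def dist_norm)
    qed
    have ae: "ball_avg ?u c (3 * r) \<le> e"
    proof (cases "R1 \<le> r")
      case True then show ?thesis using r(1) by (intro R1) auto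
    next
      case False
      have "ball c (3 * r) \<inter> ball 0 S = {}" using far_ball False \<rho>(2) by fastforce
      then show ?thesis using r(1) by (intro avg0) auto
    qed
    have ball\<rho>: "ennreal G * emeasure lebesgue (ball 0 \<rho> \<inter> ball c r) \<le> ennreal e * emeasure lebesgue (ball c r)"
    proof (cases "R1 \<le> r")
      case True
      have "ennreal G * emeasure lebesgue (ball 0 \<rho> \<inter> ball c r) \<le> ennreal G * emeasure lebesgue (ball (0::'a) \<rho>)"
        by (intro mult_left_mono emeasure_mono) (auto simp: borel_open)
      also have "\<dots> \<le> ennreal e * emeasure lebesgue (ball c r)"
        using R1(2)[OF True, of c] G(1) e
        by (simp add: emeasure_lebesgue_ball ennreal_mult[symmetric] ennreal_leI del: measure_completion)
      finally show ?thesis .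
    next
      case False
      have "y \<notin> ball 0 \<rho>" if "y \<in> ball c r" for y using far_ball[of y] False that r(1) by auto
      then have "ball 0 \<rho> \<inter> ball c r = {}" by blast
      then show ?thesis by simp
    qed
    obtain H where H: "H \<in> borel_measurable lebesgue"
      "\<And>x. x \<in> ball c r \<Longrightarrow> maximal_upto ?v r x \<le> ennreal (ball_avg ?v c (3 * r)) + H x"
      "(\<integral>\<^sup>+x\<in>ball c r. H x \<partial>lebesgue) \<le> ennreal (8 * 90 ^ ?n * (2 * e)) * emeasure lebesgue (ball c r)"
    proof (rule maximal_upto_excess[OF v, of "2 * e" r c])
      show "mean_osc ?v z s \<le> 2 * e" if "0 < s" for z s
        using mean_osc_norm_le[OF hl that, of z] h[OF that, of z] by simp
    qed (use e r in auto)
    note [measurable] = H(1)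
    \<comment> \<open>One \<open>e\<close> pays for returning from the mean of |f - g| to
      \<open>m\<close>, through |f - g| <= |f| + |g|; the other comes with the indicator from
      \<open>Mu\<close>.\<close>
    define H' where "H' x = (ennreal e + ennreal e) + (H x + ennreal G * indicator (ball 0 \<rho>) x)" for x
    have avg: "ennreal (ball_avg ?v c (3 * r)) \<le> m + ennreal e"
    proof -
      have "ball_avg ?v c (3 * r) \<le> ball_avg ?w c (3 * r) + ball_avg ?u c (3 * r)"
        unfolding ball_avg_add[OF w u, symmetric] by (intro ball_avg_mono v vwu locally_integrable_add w u)
      then have "ennreal (ball_avg ?v c (3 * r)) \<le> ennreal (ball_avg ?w c (3 * r) + e)"
        using ae by (intro ennreal_leI) simp
      also have "\<dots> = ennreal (ball_avg ?w c (3 * r)) + ennreal e"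
        using e by (simp add: ball_avg_nonneg)
      also have "ennreal (ball_avg ?w c (3 * r)) \<le> m"
        unfolding m(1) using r by (intro INF_greatest ball_avg_le_maximal f) auto
      finally show ?thesis by (simp add: add_right_mono)
    qed
    have "(\<integral>\<^sup>+x\<in>ball c r. (maximal f x - m) \<partial>lebesgue)
        \<le> ennreal ((2 * e + 8 * 90 ^ ?n * (2 * e) + e) + 3 ^ ?n * (6 * e)) * emeasure lebesgue (ball c r)"
    proof (rule maximal_excess[OF f r(1) m])
      show [measurable]: "H' \<in> borel_measurable lebesgue" unfolding H'_def by measurable
      show "maximal_upto ?w r x \<le> m + H' x" if x: "x \<in> ball c r" for x
      proof -
        have "maximal_upto ?w r x \<le> maximal_upto ?v r x + maximal_upto ?u r x"
          by (rule maximal_upto_add_le[OF w v u wuv]) auto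
        also have "\<dots> \<le> (m + ennreal e + H x) + (ennreal e + ennreal G * indicator (ball 0 \<rho>) x)"
          using H(2)[OF x] avg by (intro add_mono Mu) (meson add_right_mono order_trans)
        also have "\<dots> = m + H' x" unfolding H'_def by (simp add: ac_simps)
        finally show ?thesis .
      qed
      have "(\<integral>\<^sup>+x\<in>ball c r. H' x \<partial>lebesgue) = (\<integral>\<^sup>+x. (ennreal e + ennreal e) * indicator (ball c r) x
          + (H x * indicator (ball c r) x + ennreal G * indicator (ball 0 \<rho> \<inter> ball c r) x) \<partial>lebesgue)"
        unfolding H'_def by (intro nn_integral_cong) (auto simp: indicator_def)
      also have "\<dots> = (ennreal e + ennreal e) * emeasure lebesgue (ball c r)
          + ((\<integral>\<^sup>+x\<in>ball c r. H x \<partial>lebesgue) + ennreal G * emeasure lebesgue (ball 0 \<rho> \<inter> ball c r))"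
        by (subst nn_integral_add, measurable, subst nn_integral_add, measurable)
           (simp add: nn_integral_cmult_indicator)
      also have "\<dots> \<le> (ennreal e + ennreal e) * emeasure lebesgue (ball c r)
          + (ennreal (8 * 90 ^ ?n * (2 * e)) * emeasure lebesgue (ball c r) + ennreal e * emeasure lebesgue (ball c r))"
        by (intro add_left_mono add_mono H(3) ball\<rho>)
      also have "\<dots> = ennreal (2 * e + 8 * 90 ^ ?n * (2 * e) + e) * emeasure lebesgue (ball c r)"
      proof -
        have "ennreal (2 * e + 8 * 90 ^ ?n * (2 * e) + e)
            = (ennreal e + ennreal e) + (ennreal (8 * 90 ^ ?n * (2 * e)) + ennreal e)"
          using e by (simp add: ennreal_plus[symmetric] add.assoc del: ennreal_plus)
        then show ?thesis by (simp only: distrib_right)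
      qed
      finally show "(\<integral>\<^sup>+x\<in>ball c r. H' x \<partial>lebesgue)
          \<le> ennreal (2 * e + 8 * 90 ^ ?n * (2 * e) + e) * emeasure lebesgue (ball c r)" .
      fix z s assume s: "r < s" "ball z s \<inter> ball c r \<noteq> {}"
      define t where "t = s + 2 * r"
      have t: "0 < t" "s \<le> t" "t \<le> 3 * s" unfolding t_def using s r by auto
      \<comment> \<open>If t < R0, then r + s < R0 as well, so the enlarged ball stays within 2 R0
        of the distant centre c and misses \<open>ball 0 S\<close>.\<close>
      have "ball_avg ?u z t \<le> e"
      proof (cases "R0 \<le> t")
        case True then show ?thesis by (rule R0)
      next
        case False
        then have "R \<le> norm c" using r s R0 R1 \<rho> unfolding R_def t_def by auto
        from s(2) obtain x where x: "dist z x < s" "dist c x < r" by auto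
        have "y \<notin> ball 0 S" if "y \<in> ball z t" for y
        proof -
          have "dist c y \<le> dist c x + dist z x + dist z y"
            using dist_triangle[of c y x] dist_triangle[of x y z] by (simp add: dist_commute)
          then have "dist c y < 2 * R0"
            using x that False s(1) r(1) unfolding t_def by auto
          then show ?thesis
            using \<open>R \<le> norm c\<close> norm_triangle_sub[of c y] R0(1) R1(1) \<rho>
            by (auto simp: R_def dist_norm)
        qed
        then have "ball z t \<inter> ball 0 S = {}" by blast
        then show ?thesis using t by (intro avg0) auto
      qed
      then have "mean_osc g z t \<le> 2 * e" using mean_osc_le_avg[OF gl t(1), of z] by simp
      moreover have "mean_osc f z t \<le> mean_osc ?h z t + mean_osc g z t"
        using mean_osc_add_le[OF hl gl, of z t] by simp
      ultimately have osc: "mean_osc ?w z t \<le> 6 * e"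
        using mean_osc_norm_le[OF f t(1), of z] h[OF t(1), of z] by simp
      have "\<bar>ball_avg ?w z s - ball_avg ?w z t\<bar> \<le> 3 ^ ?n * mean_osc ?w z t"
        using s r t by (intro ball_avg_nested_le w subset_ball) auto
      also have "\<dots> \<le> 3 ^ ?n * (6 * e)" by (intro mult_left_mono osc) auto
      finally show "ball_avg ?w z s \<le> ball_avg ?w z (s + 2 * r) + 3 ^ ?n * (6 * e)" unfolding t_def by linarith
    qed (use e in auto)
    \<comment> \<open>The sum is at most (3 + 16 + 6) 90^n e; 54 is taken to share the constant of
      the small balls.\<close>
    also have "\<dots> \<le> ennreal (54 * 90 ^ ?n * e) * emeasure lebesgue (ball c r)"
    proof (intro mult_right_mono ennreal_leI)
      have "3 ^ ?n * (6 * e) \<le> 90 ^ ?n * (6 * e)" using e by (intro mult_right_mono power_mono) auto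
      moreover have "1 * (3 * e) \<le> 90 ^ ?n * (3 * e)" using e by (intro mult_right_mono) auto
      moreover have "90 ^ ?n * (25 * e) \<le> 90 ^ ?n * (54 * e)" using e by (intro mult_left_mono) auto
      ultimately show "(2 * e + 8 * 90 ^ ?n * (2 * e) + e) + 3 ^ ?n * (6 * e) \<le> 54 * 90 ^ ?n * e"
        by (simp add: ac_simps)
    qed simp
    finally show "(\<integral>\<^sup>+x\<in>ball c r. (maximal f x - m) \<partial>lebesgue)
        \<le> ennreal (54 * 90 ^ ?n * e) * emeasure lebesgue (ball c r)" .
  qed
qed

subsection \<open>Smoothing, cutting off and uniform approximation\<close>

text \<open>Dominated convergence: the indicators of the moving balls converge off the limiting
  sphere, a null set, and all the balls have the same volume.\<close>

lemma continuous_on_ball_avg: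
  fixes F :: "'a::euclidean_space \<Rightarrow> real"
  assumes F: "locally_integrable F" and d: "d > 0"
  shows "continuous_on UNIV (\<lambda>x. ball_avg F x d)"
proof (rule continuous_on_sequentiallyI)
  fix X and x :: 'a assume X: "X \<longlonglongrightarrow> x"
  have [measurable]: "F \<in> borel_measurable lebesgue" by (rule locally_integrable_borel[OF F])
  have "(\<lambda>k. LINT y|lebesgue. indicat_real (ball (X k) d) y *\<^sub>R F y)
      \<longlonglongrightarrow> (LINT y|lebesgue. indicat_real (ball x d) y *\<^sub>R F y)"
  proof -
    obtain M where M: "\<And>k. norm (X k) \<le> M"
      using convergent_imp_Bseq[of X] X unfolding convergent_def Bseq_def by blast
    show ?thesis
    proof (rule integral_dominated_convergence)
      show "integrable lebesgue (\<lambda>y. norm (indicat_real (ball 0 (M + d)) y *\<^sub>R F y))"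
        using locally_integrable_ball[OF F, of 0 "M + d"] unfolding set_integrable_def
        by (rule integrable_norm)
      show "AE y in lebesgue. norm (indicat_real (ball (X k) d) y *\<^sub>R F y)
          \<le> norm (indicat_real (ball 0 (M + d)) y *\<^sub>R F y)" for k
      proof (rule AE_I2)
        fix y
        have "y \<in> ball 0 (M + d)" if "y \<in> ball (X k) d"
          using that M[of k] norm_triangle_sub[of y "X k"] by (simp add: dist_norm norm_minus_commute)
        then show "norm (indicat_real (ball (X k) d) y *\<^sub>R F y)
            \<le> norm (indicat_real (ball 0 (M + d)) y *\<^sub>R F y)"
          by (auto simp: indicator_def)
      qed
      have "sphere x d \<in> null_sets lebesgue"
        using negligible_sphere[of x d] by (simp add: negligible_iff_null_sets)
      then have "AE y in lebesgue. y \<notin> sphere x d" by (rule AE_not_in)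
      then show "AE y in lebesgue. (\<lambda>k. indicat_real (ball (X k) d) y *\<^sub>R F y)
          \<longlonglongrightarrow> indicat_real (ball x d) y *\<^sub>R F y"
      proof eventually_elim
        case (elim y)
        have lim: "(\<lambda>k. dist (X k) y) \<longlonglongrightarrow> dist x y" by (intro tendsto_intros X)
        have "eventually (\<lambda>k. indicat_real (ball (X k) d) y = indicat_real (ball x d) y) sequentially"
        proof (cases "dist x y < d")
          case True
          from order_tendstoD(2)[OF lim this] show ?thesis by eventually_elim (use True in simp)
        next
          case False
          then have "d < dist x y" using elim by simp
          from order_tendstoD(1)[OF lim this] show ?thesis by eventually_elim (use False in simp)
        qed
        then have "eventually (\<lambda>k. indicat_real (ball (X k) d) y *\<^sub>R F y = indicat_real (ball x d) y *\<^sub>R F y)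
            sequentially"
          by eventually_elim simp
        then show ?case by (rule tendsto_eventually)
      qed
    qed measurable
  qed
  moreover have "measure lebesgue (ball (X k) d) = measure lebesgue (ball x d)" for k
    using measure_lebesgue_ball[of d "X k"] measure_lebesgue_ball[of d x] d by linarith
  ultimately show "(\<lambda>k. ball_avg F (X k) d) \<longlonglongrightarrow> ball_avg F x d"
    unfolding ball_avg_def set_lebesgue_integral_def by (simp only:) (intro tendsto_intros)
qed

text \<open>For \<open>r \<le> d\<close> both F and its average oscillate little. For larger
  \<open>r\<close> the average of |F - A| over every ball of radius \<open>d\<close> is at most 3 *
  2^n e, and a covering transfers this to \<open>ball c r\<close>: 5^n for the Vitali dilates and
  2^n for passing to \<open>ball c (2 * r)\<close> give 3 * 20^n e.\<close>

lemma mean_osc_diff_ball_avg_le: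
  fixes F :: "'a::euclidean_space \<Rightarrow> real"
  assumes F: "locally_integrable F" and d: "d > 0" and e: "e > 0"
    and osc: "\<And>c r. 0 < r \<Longrightarrow> r \<le> 2 * d \<Longrightarrow> mean_osc F c r \<le> e"
    and r: "r > 0"
  shows "mean_osc (\<lambda>x. F x - ball_avg F x d) c r \<le> 6 * 20 ^ DIM('a) * e"
proof -
  let ?n = "DIM('a)" and ?A = "\<lambda>x. ball_avg F x d"
  let ?D = "\<lambda>x. norm (F x - ?A x)"
  have A: "locally_integrable ?A" by (rule locally_integrable_continuous[OF continuous_on_ball_avg[OF F d]])
  have FA: "locally_integrable (\<lambda>x. F x - ?A x)" by (rule locally_integrable_diff[OF F A])
  have Dl: "locally_integrable ?D" by (rule locally_integrable_norm[OF FA])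
  \<comment> \<open>Both balls of radius \<open>d\<close> lie in \<open>ball x (2 * d)\<close>,
    whose mean serves as the intermediate value.\<close>
  have close: "\<bar>?A x - ?A y\<bar> \<le> 2 * 2 ^ ?n * e" if "dist x y \<le> d" for x y
  proof -
    have m: "2 ^ ?n * mean_osc F x (2 * d) \<le> 2 ^ ?n * e" using d by (intro mult_left_mono osc) auto
    have "ball y d \<subseteq> ball x (2 * d)"
    proof
      fix z assume "z \<in> ball y d"
      then show "z \<in> ball x (2 * d)" using that dist_triangle[of x z y] by simp
    qed
    then have "\<bar>?A y - ball_avg F x (2 * d)\<bar> \<le> 2 ^ ?n * mean_osc F x (2 * d)"
      using d by (intro ball_avg_nested_le F) auto
    moreover have "\<bar>?A x - ball_avg F x (2 * d)\<bar> \<le> 2 ^ ?n * mean_osc F x (2 * d)"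
      using d by (intro ball_avg_nested_le F subset_ball) auto
    ultimately show ?thesis using m by linarith
  qed
  have p: "(2::real) ^ ?n \<ge> 1" "(2::real) ^ ?n \<le> 20 ^ ?n" by (auto intro: power_mono)
  show ?thesis
  proof (cases "r \<le> d")
    case True
    have "mean_osc ?A c r \<le> 2 * ball_avg (\<lambda>x. norm (?A x - ?A c)) c r"
      by (rule mean_osc_le[OF A r])
    also have "\<dots> \<le> 2 * ball_avg (\<lambda>x. 2 * 2 ^ ?n * e) c r"
    proof (intro mult_left_mono ball_avg_mono_on locally_integrable_const
        locally_integrable_norm[OF locally_integrable_diff[OF A locally_integrable_const]])
      fix x assume "x \<in> ball c r"
      then show "norm (?A x - ?A c) \<le> 2 * 2 ^ ?n * e"
        using close[of x c] True by (simp add: dist_commute)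
    qed simp
    also have "\<dots> = 4 * 2 ^ ?n * e" using r by (simp add: ball_avg_const)
    finally have "mean_osc (\<lambda>x. F x - ?A x) c r \<le> e + 4 * 2 ^ ?n * e"
      using mean_osc_diff_le[OF F A, of c r] osc[of r c] r True d by simp
    also have "\<dots> \<le> 6 * 20 ^ ?n * e"
    proof -
      have "1 * e \<le> 20 ^ ?n * e" using p e by (intro mult_right_mono) auto
      moreover have "2 ^ ?n * e \<le> 20 ^ ?n * e" using p e by (intro mult_right_mono) auto
      moreover have "0 \<le> 20 ^ ?n * e" using e by simp
      ultimately show ?thesis by linarith
    qed
    finally show ?thesis .
  next
    case False
    define \<kappa> where "\<kappa> = 3 * 2 ^ ?n * e"
    have \<kappa>: "\<kappa> \<ge> 0" using e by (simp add: \<kappa>_def)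
    have loc: "ball_avg ?D z d \<le> \<kappa>" for z
    proof -
      have nl: "locally_integrable (\<lambda>x. norm (F x - ?A z))"
        by (rule locally_integrable_norm[OF locally_integrable_diff[OF F locally_integrable_const]])
      have "ball_avg ?D z d \<le> ball_avg (\<lambda>x. norm (F x - ?A z) + 2 * 2 ^ ?n * e) z d"
      proof (intro ball_avg_mono_on Dl locally_integrable_add nl locally_integrable_const)
        fix x assume "x \<in> ball z d"
        then show "?D x \<le> norm (F x - ?A z) + 2 * 2 ^ ?n * e"
          using close[of z x] by simp
      qed
      also have "\<dots> = mean_osc F z d + 2 * 2 ^ ?n * e"
        unfolding mean_osc_def
        by (simp only: ball_avg_add[OF nl locally_integrable_const] ball_avg_const[OF d])
      also have "\<dots> \<le> 1 * e + 2 * 2 ^ ?n * e" using osc[of d z] d by simp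
      also have "\<dots> \<le> \<kappa>"
      proof -
        have "1 * e \<le> 2 ^ ?n * e" using p e by (intro mult_right_mono) auto
        then show ?thesis unfolding \<kappa>_def by linarith
      qed
      finally show ?thesis .
    qed
    define \<nu> where "\<nu> = density lebesgue (\<lambda>x. ennreal (?D x))"
    define \<mu> where "\<mu> = density lebesgue (\<lambda>x::'a. ennreal (\<kappa> * 5 ^ ?n))"
    note [measurable] = locally_integrable_borel[OF F] locally_integrable_borel[OF A]
    have \<nu>: "emeasure \<nu> (ball z s) = ennreal (ball_avg ?D z s) * emeasure lebesgue (ball z s)" if "s > 0" for z s
    proof -
      have "emeasure \<nu> (ball z s) = (\<integral>\<^sup>+x\<in>ball z s. ennreal (?D x) \<partial>lebesgue)"
        unfolding \<nu>_def by (subst emeasure_density) auto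
      also have "\<dots> = ennreal (ball_avg ?D z s) * emeasure lebesgue (ball z s)"
        by (rule ball_avg_eq_nn_integral[OF Dl _ that]) simp
      finally show ?thesis .
    qed
    have \<mu>: "emeasure \<mu> (ball z s) = ennreal (\<kappa> * 5 ^ ?n) * emeasure lebesgue (ball z s)" for z s
      unfolding \<mu>_def by (subst emeasure_density) (auto simp: nn_integral_cmult_indicator)
    \<comment> \<open>Radius d/5, so that the five-fold dilates are the balls to which
      \<open>loc\<close> applies.\<close>
    define K where "K = (\<lambda>z. (z, d / 5)) ` ball c r"
    have "emeasure \<nu> (ball c r) \<le> emeasure \<mu> (\<Union>(z, s)\<in>K. ball z s)"
    proof (rule vitali_cover_bound[where R = "d / 5"])
      show "ball c r \<subseteq> (\<Union>(z, s)\<in>K. ball z s)" unfolding K_def using d by fastforce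
      fix z s assume "(z, s) \<in> K"
      then have s: "s = d / 5" by (auto simp: K_def)
      show "0 < s \<and> s \<le> d / 5" using s d by simp
      have "emeasure \<nu> (ball c r \<inter> ball z (5 * s)) \<le> emeasure \<nu> (ball z d)"
        using s by (intro emeasure_mono) (auto simp: \<nu>_def)
      also have "\<dots> \<le> ennreal \<kappa> * emeasure lebesgue (ball z d)"
        unfolding \<nu>[OF d] by (intro mult_right_mono ennreal_leI loc) simp
      also have "\<dots> = ennreal (\<kappa> * 5 ^ ?n) * emeasure lebesgue (ball z s)"
        unfolding s using measure_lebesgue_ball_scale[of "d / 5" 5 z z] d \<kappa>
        by (simp add: emeasure_lebesgue_ball ennreal_mult[symmetric] del: measure_completion)
      finally show "emeasure \<nu> (ball c r \<inter> ball z (5 * s)) \<le> emeasure \<mu> (ball z s)" by (simp add: \<mu>)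
    qed (auto simp: \<mu>_def \<nu>_def)
    also have "\<dots> \<le> emeasure \<mu> (ball c (2 * r))"
    proof (rule emeasure_mono)
      show "(\<Union>(z, s)\<in>K. ball z s) \<subseteq> ball c (2 * r)"
      proof
        fix y assume "y \<in> (\<Union>(z, s)\<in>K. ball z s)"
        then obtain z where "dist c z < r" "dist z y < d / 5" by (auto simp: K_def)
        then show "y \<in> ball c (2 * r)" using False d dist_triangle[of c y z] by simp
      qed
    qed (simp add: \<mu>_def)
    also have "\<dots> = ennreal (\<kappa> * 10 ^ ?n) * emeasure lebesgue (ball c r)"
    proof -
      have "\<kappa> * 5 ^ ?n * (2 ^ ?n * q) = \<kappa> * 10 ^ ?n * q" for q :: real
        by (simp add: power_mult_distrib[symmetric] mult.assoc[symmetric])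
      then show ?thesis
        unfolding \<mu> using measure_lebesgue_ball_scale[of r 2 c c] r \<kappa>
        by (simp add: emeasure_lebesgue_ball ennreal_mult[symmetric] del: measure_completion)
    qed
    finally have "ball_avg ?D c r \<le> \<kappa> * 10 ^ ?n"
      unfolding \<nu>[OF r] using measure_lebesgue_ball_pos[OF r, of c] \<kappa>
      by (simp add: emeasure_lebesgue_ball ennreal_mult[symmetric] ball_avg_nonneg ennreal_le_iff
          del: measure_completion)
    also have "\<kappa> * 10 ^ ?n = 3 * 20 ^ ?n * e"
      unfolding \<kappa>_def by (simp add: power_mult_distrib[symmetric])
    finally show ?thesis using mean_osc_le_avg[OF FA r, of c] by simp
  qed
qed

text \<open>The seminorm ignores constants, so \<open>q\<close> may be cut off in place of
  \<open>u\<close>, and u - v is \<open>\<phi> * q\<close> up to a constant. On balls of radius at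
  least T/4 the mean of |q| over \<open>ball 0 (2 * T)\<close>, at most e, controls v. On smaller
  balls \<open>\<phi>\<close> is constant near the origin and far away; in between its Lipschitz
  constant 1/T must beat the growth of the means of q.\<close>

lemma mean_osc_cutoff:
  fixes u :: "'a::euclidean_space \<Rightarrow> real"
  assumes u: "continuous_on UNIV u" and T: "T > 0" and e: "e > 0"
    and osc: "\<And>c r. 0 < r \<Longrightarrow> T / 4 \<le> r \<or> T / 4 \<le> norm c \<Longrightarrow> mean_osc u c r \<le> e"
  obtains v where "continuous_on UNIV v" "\<And>x. x \<notin> ball 0 (2 * T) \<Longrightarrow> v x = 0"
    "\<And>c r. 0 < r \<Longrightarrow> mean_osc (\<lambda>x. u x - v x) c r \<le> 6 * 16 ^ DIM('a) * e"
proof -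
  let ?n = "DIM('a)"
  have ul: "locally_integrable u" by (rule locally_integrable_continuous[OF u])
  define q where "q x = u x - ball_avg u 0 (2 * T)" for x
  define \<phi> where "\<phi> x = max 0 (min 1 ((norm x - T) / T))" for x :: 'a
  define v where "v x = (1 - \<phi> x) * q x" for x
  have qc: "continuous_on UNIV q" unfolding q_def by (intro continuous_intros u)
  have \<phi>c: "continuous_on UNIV \<phi>" unfolding \<phi>_def using T by (intro continuous_intros) auto
  have vc: "continuous_on UNIV v" unfolding v_def by (intro continuous_intros qc \<phi>c)
  have \<phi>qc: "continuous_on UNIV (\<lambda>x. \<phi> x * q x)" by (intro continuous_intros qc \<phi>c)
  have ql: "locally_integrable q" by (rule locally_integrable_continuous[OF qc])
  have qn: "locally_integrable (\<lambda>x. norm (q x))" by (rule locally_integrable_norm[OF ql])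
  have vl: "locally_integrable v" by (rule locally_integrable_continuous[OF vc])
  have \<phi>ql: "locally_integrable (\<lambda>x. \<phi> x * q x)" by (rule locally_integrable_continuous[OF \<phi>qc])
  have \<phi>01: "0 \<le> \<phi> x" "\<phi> x \<le> 1" for x unfolding \<phi>_def by auto
  have \<phi>1: "\<phi> x = 1" if "2 * T \<le> norm x" for x
    using that T unfolding \<phi>_def by (simp add: field_simps)
  have \<phi>0: "\<phi> x = 0" if "norm x \<le> T" for x
    using that T unfolding \<phi>_def by (simp add: field_simps)
  have \<phi>lip: "\<bar>\<phi> x - \<phi> y\<bar> \<le> dist x y / T" for x y
  proof -
    have "\<bar>(norm x - T) / T - (norm y - T) / T\<bar> = \<bar>norm x - norm y\<bar> / T"
      using T by (simp add: diff_divide_distrib[symmetric])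
    also have "\<dots> \<le> dist x y / T"
      using T norm_triangle_ineq3[of x y] by (intro divide_right_mono) (auto simp: dist_norm)
    finally show ?thesis unfolding \<phi>_def by linarith
  qed
  have oscq: "mean_osc q c r \<le> e" if "0 < r" "T / 4 \<le> r \<or> T / 4 \<le> norm c" for c r
    unfolding q_def using mean_osc_diff_const[OF ul that(1)] osc[OF that] by simp
  have avgq0: "ball_avg q 0 (2 * T) = 0"
    unfolding q_def using T by (simp add: ball_avg_diff[OF ul locally_integrable_const] ball_avg_const)
  have avgnq0: "ball_avg (\<lambda>x. norm (q x)) 0 (2 * T) \<le> e"
    using oscq[of "2 * T" 0] T unfolding mean_osc_def avgq0 by simp
  have p: "(1::real) \<le> 16 ^ ?n" "(2::real) ^ ?n \<le> 16 ^ ?n" "(8::real) ^ ?n \<le> 16 ^ ?n"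
    by (auto intro: power_mono)
  have pe: "1 * e \<le> 16 ^ ?n * e" "2 ^ ?n * e \<le> 16 ^ ?n * e" "8 ^ ?n * e \<le> 16 ^ ?n * e"
    using p e by (intro mult_right_mono; simp)+
  have pe0: "0 \<le> 16 ^ ?n * e" using e by simp
  \<comment> \<open>Starting scale: \<open>q\<close> has mean 0 over \<open>ball 0 (2 * T)\<close>,
    and the two means are compared through \<open>ball 0 (4 * T)\<close>. The 16 is 4T divided by
    T/4.\<close>
  have base: "s * \<bar>ball_avg q c s\<bar> \<le> T * 16 ^ ?n * e"
    if s: "T / 4 \<le> s" "s \<le> T / 2" and c: "norm c \<le> 3 * T" for s c
  proof -
    have m: "mean_osc q 0 (4 * T) \<le> e" using T by (intro oscq) auto
    have "ball c s \<subseteq> ball 0 (4 * T)"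
    proof
      fix x assume "x \<in> ball c s"
      then show "x \<in> ball 0 (4 * T)"
        using s c T norm_triangle_sub[of x c] by (simp add: dist_norm norm_minus_commute)
    qed
    then have "\<bar>ball_avg q c s - ball_avg q 0 (4 * T)\<bar> \<le> 16 ^ ?n * mean_osc q 0 (4 * T)"
      using s T by (intro ball_avg_nested_le ql) auto
    moreover have "\<bar>ball_avg q 0 (2 * T) - ball_avg q 0 (4 * T)\<bar> \<le> 2 ^ ?n * mean_osc q 0 (4 * T)"
      using T by (intro ball_avg_nested_le ql subset_ball) auto
    moreover have "16 ^ ?n * mean_osc q 0 (4 * T) \<le> 16 ^ ?n * e" using m by (intro mult_left_mono) auto
    moreover have "2 ^ ?n * mean_osc q 0 (4 * T) \<le> 2 ^ ?n * e" using m by (intro mult_left_mono) auto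
    ultimately have "\<bar>ball_avg q c s\<bar> \<le> 2 * (16 ^ ?n * e)" using avgq0 pe(2) by linarith
    then have "s * \<bar>ball_avg q c s\<bar> \<le> (T / 2) * (2 * (16 ^ ?n * e))"
      using s T by (intro mult_mono) auto
    then show ?thesis by simp
  qed
  (* |q_B(c,r)| grows logarithmically as r tends to 0; halving r loses only a constant, so r times it
     stays bounded by induction. *)
  have chain: "r * \<bar>ball_avg q c r\<bar> \<le> 2 * T * 16 ^ ?n * e"
    if "T / 4 \<le> 2 ^ k * r" "0 < r" "r \<le> T / 2" and c: "T / 2 \<le> norm c" "norm c \<le> 3 * T" for k r c
    using that(1-3)
  proof (induction k arbitrary: r)
    case 0
    have "0 \<le> T * 16 ^ ?n * e" using T e by simp
    then show ?case using base[OF _ 0(3) c(2)] 0(1) by simp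
  next
    case (Suc k)
    show ?case
    proof (cases "T / 4 \<le> r")
      case True
      have "0 \<le> T * 16 ^ ?n * e" using T e by simp
      then show ?thesis using base[OF True Suc.prems(3) c(2)] by simp
    next
      case False
      have IH: "2 * r * \<bar>ball_avg q c (2 * r)\<bar> \<le> 2 * T * 16 ^ ?n * e"
        using Suc.prems False by (intro Suc.IH) (auto simp: ac_simps)
      have "\<bar>ball_avg q c r - ball_avg q c (2 * r)\<bar> \<le> 2 ^ ?n * mean_osc q c (2 * r)"
        using Suc.prems by (intro ball_avg_nested_le ql subset_ball) auto
      also have "\<dots> \<le> 2 ^ ?n * e" using Suc.prems c(1) T by (intro mult_left_mono oscq) auto
      finally have "\<bar>ball_avg q c r\<bar> \<le> \<bar>ball_avg q c (2 * r)\<bar> + 16 ^ ?n * e" using pe(2) by linarith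
      then have "r * \<bar>ball_avg q c r\<bar> \<le> r * (\<bar>ball_avg q c (2 * r)\<bar> + 16 ^ ?n * e)"
        using Suc.prems by (intro mult_left_mono) auto
      also have "\<dots> = r * \<bar>ball_avg q c (2 * r)\<bar> + r * (16 ^ ?n * e)" by (simp add: distrib_left)
      also have "r * (16 ^ ?n * e) \<le> T * (16 ^ ?n * e)"
        using False T e by (intro mult_right_mono) auto
      finally show ?thesis using IH by simp
    qed
  qed
  have main: "mean_osc (\<lambda>x. \<phi> x * q x) c r \<le> 6 * 16 ^ ?n * e" if r: "0 < r" for c r
  proof (cases "T / 4 \<le> r")
    case True
    \<comment> \<open>\<open>v\<close> lives in \<open>ball 0 (2 * T)\<close>, which has at most the
      volume of a ball of radius 8r because r >= T/4.\<close>
    have "ball_avg (\<lambda>x. norm (v x)) c r \<le> 8 ^ ?n * e"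
    proof -
      have "ennreal (ball_avg (\<lambda>x. norm (v x)) c r) * emeasure lebesgue (ball c r)
          = (\<integral>\<^sup>+x\<in>ball c r. ennreal (norm (v x)) \<partial>lebesgue)"
        by (rule ball_avg_eq_nn_integral[symmetric, OF locally_integrable_norm[OF vl] _ r]) simp
      also have "\<dots> \<le> (\<integral>\<^sup>+x\<in>ball 0 (2 * T). ennreal (norm (q x)) \<partial>lebesgue)"
      proof (intro nn_integral_mono)
        fix x
        have "norm (v x) = (1 - \<phi> x) * norm (q x)" using \<phi>01 by (simp add: v_def abs_mult)
        also have "\<dots> \<le> 1 * norm (q x)" using \<phi>01[of x] by (intro mult_right_mono) auto
        finally have "norm (v x) \<le> norm (q x)" by simp
        moreover have "v x = 0" if "x \<notin> ball 0 (2 * T)" using that \<phi>1[of x] by (simp add: v_def)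
        ultimately show "ennreal (norm (v x)) * indicator (ball c r) x
            \<le> ennreal (norm (q x)) * indicator (ball 0 (2 * T)) x"
          by (cases "x \<in> ball 0 (2 * T)") (auto simp: indicator_def ennreal_leI)
      qed
      also have "\<dots> = ennreal (ball_avg (\<lambda>x. norm (q x)) 0 (2 * T)) * emeasure lebesgue (ball (0::'a) (2 * T))"
        by (rule ball_avg_eq_nn_integral[OF qn]) (use T in auto)
      also have "\<dots> \<le> ennreal e * emeasure lebesgue (ball (0::'a) (8 * r))"
        using True by (intro mult_mono[OF ennreal_leI[OF avgnq0] emeasure_mono[OF subset_ball]])
          (auto simp: borel_open)
      also have "\<dots> = ennreal (8 ^ ?n * e) * emeasure lebesgue (ball c r)"
        using measure_lebesgue_ball_scale[of r 8 0 c] r e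
        by (simp add: emeasure_lebesgue_ball ennreal_mult[symmetric] ac_simps del: measure_completion)
      finally show ?thesis
        using measure_lebesgue_ball_pos[OF r, of c] e
        by (simp add: emeasure_lebesgue_ball ennreal_mult[symmetric] ball_avg_nonneg ennreal_le_iff
            del: measure_completion)
    qed
    then have "mean_osc v c r \<le> 2 * (16 ^ ?n * e)" using mean_osc_le_avg[OF vl r, of c] pe(3) by simp
    moreover have "(\<lambda>x. \<phi> x * q x) = (\<lambda>x. q x - v x)" by (auto simp: v_def algebra_simps)
    then have "mean_osc (\<lambda>x. \<phi> x * q x) c r \<le> mean_osc q c r + mean_osc v c r"
      using mean_osc_diff_le[OF ql vl] by simp
    moreover have "mean_osc q c r \<le> e" using True r by (intro oscq) auto
    ultimately show ?thesis using pe(1) pe0 by linarith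
  next
    case False
    have R0: "0 \<le> 6 * 16 ^ ?n * e" using e by simp
    consider "norm c < T / 2" | "3 * T < norm c" | "T / 2 \<le> norm c" "norm c \<le> 3 * T" by linarith
    then show ?thesis
    proof cases
      case 1
      have "norm (\<phi> x * q x) \<le> 0" if "x \<in> ball c r" for x
        using that 1 False T norm_triangle_sub[of x c] \<phi>0[of x] by (simp add: dist_norm norm_minus_commute)
      then have "ball_avg (\<lambda>x. norm (\<phi> x * q x)) c r \<le> ball_avg (\<lambda>x. 0) c r"
        by (intro ball_avg_mono_on locally_integrable_norm[OF \<phi>ql] locally_integrable_const)
      then have "ball_avg (\<lambda>x. norm (\<phi> x * q x)) c r \<le> 0" using r by (simp add: ball_avg_const)
      then show ?thesis using mean_osc_le_avg[OF \<phi>ql r, of c] R0 by linarith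
    next
      case 2
      define a where "a = ball_avg q c r"
      have "norm (\<phi> x * q x - a) \<le> norm (q x - a)" if "x \<in> ball c r" for x
        using that 2 False T norm_triangle_sub[of c x] \<phi>1[of x] by (simp add: dist_norm)
      then have "ball_avg (\<lambda>x. norm (\<phi> x * q x - a)) c r \<le> ball_avg (\<lambda>x. norm (q x - a)) c r"
        by (intro ball_avg_mono_on locally_integrable_norm locally_integrable_diff \<phi>ql ql locally_integrable_const)
      moreover have "mean_osc q c r \<le> e" using 2 T r by (intro oscq) auto
      ultimately show ?thesis
        using mean_osc_le[OF \<phi>ql r, of c a] pe(1) pe0 unfolding mean_osc_def[of q] a_def[symmetric]
        by linarith
    next
      case 3
      define a where "a = ball_avg q c r"
      have nl: "locally_integrable (\<lambda>x. norm (q x - a))"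
        by (intro locally_integrable_norm locally_integrable_diff ql locally_integrable_const)
      \<comment> \<open>With centre \<open>\<phi> c * a\<close> the error splits into the deviation
        of \<open>q\<close> and |a| times the variation of \<open>\<phi>\<close>, at most r/T;
        \<open>chain\<close> bounds r |a|.\<close>
      have "norm (\<phi> x * q x - \<phi> c * a) \<le> norm (q x - a) + \<bar>a\<bar> * r / T" if "x \<in> ball c r" for x
      proof -
        have "\<phi> x * q x - \<phi> c * a = \<phi> x * (q x - a) + a * (\<phi> x - \<phi> c)" by (simp add: algebra_simps)
        also have "norm \<dots> \<le> norm (\<phi> x * (q x - a)) + norm (a * (\<phi> x - \<phi> c))" by (rule norm_triangle_ineq)
        also have "norm (\<phi> x * (q x - a)) \<le> 1 * norm (q x - a)"
          unfolding norm_mult using \<phi>01[of x] by (intro mult_right_mono) auto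
        also have "norm (a * (\<phi> x - \<phi> c)) \<le> \<bar>a\<bar> * (r / T)"
        proof -
          have "dist x c / T \<le> r / T" using that T by (intro divide_right_mono) (auto simp: dist_commute)
          then have "\<bar>\<phi> x - \<phi> c\<bar> \<le> r / T" using \<phi>lip[of x c] by linarith
          then show ?thesis unfolding real_norm_def abs_mult by (intro mult_left_mono) auto
        qed
        finally show ?thesis by simp
      qed
      then have "ball_avg (\<lambda>x. norm (\<phi> x * q x - \<phi> c * a)) c r \<le> ball_avg (\<lambda>x. norm (q x - a) + \<bar>a\<bar> * r / T) c r"
        by (intro ball_avg_mono_on locally_integrable_add nl locally_integrable_const
            locally_integrable_norm[OF locally_integrable_diff[OF \<phi>ql locally_integrable_const]])
      also have "\<dots> = mean_osc q c r + \<bar>a\<bar> * r / T"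
        unfolding mean_osc_def a_def[symmetric]
        by (simp only: ball_avg_add[OF nl locally_integrable_const] ball_avg_const[OF r])
      also have "\<bar>a\<bar> * r / T \<le> 2 * 16 ^ ?n * e"
      proof -
        obtain k where "T / (4 * r) < 2 ^ k" using real_arch_pow[of 2 "T / (4 * r)"] by auto
        then have "T / 4 \<le> 2 ^ k * r" using r by (simp add: field_simps)
        from chain[OF this r _ 3] False T have "r * \<bar>a\<bar> \<le> 2 * T * 16 ^ ?n * e" unfolding a_def by simp
        then show ?thesis using T by (simp add: field_simps)
      qed
      also have "mean_osc q c r \<le> e" using 3 T r by (intro oscq) auto
      finally show ?thesis using mean_osc_le[OF \<phi>ql r, of c "\<phi> c * a"] pe(1) by simp
    qed
  qed
  show ?thesis
  proof (rule that[OF vc])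
    show "v x = 0" if "x \<notin> ball 0 (2 * T)" for x using that \<phi>1[of x] by (simp add: v_def)
    fix c r assume r: "(0::real) < r"
    have "(\<lambda>x. u x - v x) = (\<lambda>x. \<phi> x * q x - (- ball_avg u 0 (2 * T)))"
      by (auto simp: v_def q_def algebra_simps)
    then show "mean_osc (\<lambda>x. u x - v x) c r \<le> 6 * 16 ^ ?n * e"
      using mean_osc_diff_const[OF \<phi>ql r, of "- ball_avg u 0 (2 * T)" c] main[OF r, of c] by simp
  qed
qed

section \<open>Smooth bump functions\<close>

definition flat_exp :: "nat \<Rightarrow> real \<Rightarrow> real" where
  "flat_exp k t = (if t > 0 then exp (- (1 / t)) / t ^ k else 0)"

lemma tendsto_flat_exp_at_0: "(flat_exp k \<longlongrightarrow> 0) (at 0)"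
proof -
  have "((\<lambda>t::real. inverse t ^ k / exp (inverse t)) \<longlongrightarrow> 0) (at_right 0)"
    by (rule filterlim_compose[OF tendsto_power_div_exp_0 filterlim_inverse_at_top_right])
  moreover have "eventually (\<lambda>t::real. inverse t ^ k / exp (inverse t) = flat_exp k t) (at_right 0)"
    by (rule eventually_at_rightI[of 0 1])
       (auto simp: flat_exp_def exp_minus field_simps power_inverse inverse_eq_divide)
  ultimately have "(flat_exp k \<longlongrightarrow> 0) (at_right 0)"
    by (rule Lim_transform_eventually)
  moreover have "(flat_exp k \<longlongrightarrow> 0) (at_left 0)"
    by (rule tendsto_eventually, rule eventually_at_leftI[of "-1"]) (auto simp: flat_exp_def)
  ultimately show ?thesis by (simp add: filterlim_at_split)
qed

text \<open>The powers in the denominator make the span of the family closed under differentiation,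
  so one formula settles all orders. At 0 the difference quotient of \<open>flat_exp k\<close> is
  \<open>flat_exp (Suc k)\<close>, which tends to 0.\<close>

lemma has_real_derivative_flat_exp:
  "(flat_exp k has_real_derivative (flat_exp (k + 2) t - real k * flat_exp (k + 1) t)) (at t)"
proof -
  consider "t > 0" | "t < 0" | "t = 0" by linarith
  then show ?thesis
  proof cases
    case 1
    have "((\<lambda>t. exp (- (1 / t)) / t ^ k) has_real_derivative
        (exp (- (1 / t)) * (1 / t\<^sup>2) * t ^ k - exp (- (1 / t)) * (real k * t ^ (k - 1))) / (t ^ k * t ^ k)) (at t)"
    proof (rule DERIV_divide)
      have "((\<lambda>t. - (1 / t)) has_real_derivative 1 / t\<^sup>2) (at t)"
        using DERIV_minus[OF DERIV_inverse[of t]] 1 by (simp add: inverse_eq_divide power2_eq_square)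
      then show "((\<lambda>t. exp (- (1 / t))) has_real_derivative exp (- (1 / t)) * (1 / t\<^sup>2)) (at t)"
        by (rule DERIV_fun_exp)
      show "((\<lambda>t. t ^ k) has_real_derivative real k * t ^ (k - 1)) (at t)"
        using DERIV_pow[of k t] by simp
    qed (use 1 in simp)
    also have "(exp (- (1 / t)) * (1 / t\<^sup>2) * t ^ k - exp (- (1 / t)) * (real k * t ^ (k - 1))) / (t ^ k * t ^ k)
        = flat_exp (k + 2) t - real k * flat_exp (k + 1) t"
      using 1 by (cases k) (simp_all add: flat_exp_def power2_eq_square diff_divide_distrib)
    finally have "((\<lambda>t. exp (- (1 / t)) / t ^ k) has_real_derivative
        (flat_exp (k + 2) t - real k * flat_exp (k + 1) t)) (at t)" .
    then show ?thesis
      by (rule has_field_derivative_transform_within_open[of _ _ _ "{0<..}"]) (use 1 in \<open>auto simp: flat_exp_def\<close>)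
  next
    case 2
    have "((\<lambda>s. 0) has_real_derivative (flat_exp (k + 2) t - real k * flat_exp (k + 1) t)) (at t)"
      using 2 by (simp add: flat_exp_def)
    then show ?thesis
      by (rule has_field_derivative_transform_within_open[of _ _ _ "{..<0}"]) (use 2 in \<open>auto simp: flat_exp_def\<close>)
  next
    case 3
    have eq: "flat_exp (Suc k) h = (flat_exp k (0 + h) - flat_exp k 0) / h" for h
      by (simp add: flat_exp_def)
    have "(\<lambda>h. (flat_exp k (0 + h) - flat_exp k 0) / h) \<midarrow>0\<rightarrow> 0"
      unfolding eq[symmetric] by (rule tendsto_flat_exp_at_0)
    moreover have "flat_exp (k + 2) t - real k * flat_exp (k + 1) t = 0"
      using 3 by (simp add: flat_exp_def)
    ultimately show ?thesis unfolding 3 DERIV_def by simp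
  qed
qed

text \<open>\<open>C_diff\<close> differentiates again after fixing a direction, so each directional
  derivative must be known to be a polynomial.\<close>

lemma has_derivative_real_polynomial_function:
  fixes P :: "'a::euclidean_space \<Rightarrow> real"
  assumes "real_polynomial_function P"
  obtains P' where "\<And>x. (P has_derivative P' x) (at x)" "\<And>v. real_polynomial_function (\<lambda>x. P' x v)"
  using assms
proof (induction arbitrary: thesis)
  case (linear f)
  show ?case
    by (rule linear(2)[of "\<lambda>x. f"]) (use linear(1) in \<open>auto intro: bounded_linear_imp_has_derivative\<close>)
next
  case (const c)
  show ?case by (rule const[of "\<lambda>x v. 0"]) auto
next
  case (add f g)
  obtain f' where f': "\<And>x. (f has_derivative f' x) (at x)" "\<And>v. real_polynomial_function (\<lambda>x. f' x v)"
    using add.IH(1) by blast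
  obtain g' where g': "\<And>x. (g has_derivative g' x) (at x)" "\<And>v. real_polynomial_function (\<lambda>x. g' x v)"
    using add.IH(2) by blast
  show ?case
    by (rule add.prems[of "\<lambda>x v. f' x v + g' x v"]) (use f' g' in \<open>auto intro: has_derivative_add\<close>)
next
  case (mult f g)
  obtain f' where f': "\<And>x. (f has_derivative f' x) (at x)" "\<And>v. real_polynomial_function (\<lambda>x. f' x v)"
    using mult.IH(1) by blast
  obtain g' where g': "\<And>x. (g has_derivative g' x) (at x)" "\<And>v. real_polynomial_function (\<lambda>x. g' x v)"
    using mult.IH(2) by blast
  show ?case
  proof (rule mult.prems[of "\<lambda>x v. f x * g' x v + f' x v * g x"])
    show "((\<lambda>x. f x * g x) has_derivative (\<lambda>v. f x * g' x v + f' x v * g x)) (at x)" for x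
      by (rule has_derivative_mult[OF f'(1) g'(1)])
    show "real_polynomial_function (\<lambda>x. f x * g' x v + f' x v * g x)" for v
      by (intro real_polynomial_function.intros(3) real_polynomial_function.intros(4) mult.hyps f'(2) g'(2))
  qed
qed

lemma C_diff_add:
  fixes f g :: "'a::euclidean_space \<Rightarrow> 'b::euclidean_space"
  assumes "C_diff k f" "C_diff k g"
  shows "C_diff k (\<lambda>x. f x + g x)"
  using assms
proof (induction k arbitrary: f g)
  case 0
  then show ?case by (simp add: continuous_on_add)
next
  case (Suc k)
  then have d: "f differentiable (at x)" "g differentiable (at x)" for x by auto
  have eq: "frechet_derivative (\<lambda>x. f x + g x) (at x)
      = (\<lambda>v. frechet_derivative f (at x) v + frechet_derivative g (at x) v)" for x
    using has_derivative_add[OF d[unfolded frechet_derivative_works], of x]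
    by (rule frechet_derivative_at[symmetric])
  show ?case
    unfolding C_diff.simps eq
    using Suc.IH Suc.prems d by (auto intro!: differentiable_add)
qed

text \<open>Differentiation yields three terms, each again a polynomial times some
  \<open>flat_exp\<close> of the same \<open>q\<close>; hence the induction with \<open>P\<close>
  and \<open>j\<close> arbitrary.\<close>

lemma C_diff_polynomial_flat_exp:
  fixes P q :: "'a::euclidean_space \<Rightarrow> real"
  assumes q: "real_polynomial_function q" and P: "real_polynomial_function P"
  shows "C_diff k (\<lambda>x. P x * flat_exp j (q x))"
  using P
proof (induction k arbitrary: P j)
  case 0
  have cont: "continuous_on UNIV p" if "real_polynomial_function p" for p :: "'a \<Rightarrow> real"
    by (rule differentiable_imp_continuous_on[OF differentiable_on_real_polynomial_function[OF that]])
  have "continuous_on UNIV (flat_exp j)"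
    by (intro continuous_at_imp_continuous_on ballI DERIV_isCont[OF has_real_derivative_flat_exp])
  from continuous_on_compose2[OF this cont[OF q]] have "continuous_on UNIV (\<lambda>x. flat_exp j (q x))"
    by simp
  then show ?case using cont[OF 0] by (simp add: continuous_on_mult)
next
  case (Suc k)
  obtain P' where P': "\<And>x. (P has_derivative P' x) (at x)" "\<And>v. real_polynomial_function (\<lambda>x. P' x v)"
    using has_derivative_real_polynomial_function[OF Suc.prems] by blast
  obtain q' where q': "\<And>x. (q has_derivative q' x) (at x)" "\<And>v. real_polynomial_function (\<lambda>x. q' x v)"
    using has_derivative_real_polynomial_function[OF q] by blast
  let ?D = "\<lambda>x v. P' x v * flat_exp j (q x)
      + (P x * q' x v * flat_exp (j + 2) (q x) + - real j * (P x * q' x v) * flat_exp (j + 1) (q x))"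
  have der: "((\<lambda>x. P x * flat_exp j (q x)) has_derivative ?D x) (at x)" for x
  proof -
    have "((\<lambda>x. flat_exp j (q x)) has_derivative
        (\<lambda>v. (flat_exp (j + 2) (q x) - real j * flat_exp (j + 1) (q x)) * q' x v)) (at x)"
      by (rule has_derivative_compose[OF q'(1)[of x]
            has_real_derivative_flat_exp[of j "q x", unfolded has_field_derivative_def]])
    from has_derivative_mult[OF P'(1)[of x] this] show ?thesis
      by (rule has_derivative_eq_rhs) (simp add: fun_eq_iff algebra_simps)
  qed
  have "frechet_derivative (\<lambda>x. P x * flat_exp j (q x)) (at x) = ?D x" for x
    using frechet_derivative_at[OF der] by simp
  moreover have "C_diff k (\<lambda>x. ?D x v)" for v
    by (intro C_diff_add Suc.IH P' q' real_polynomial_function.intros(4) real_polynomial_function.intros(2) Suc.prems)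
  ultimately show ?case
    using der by (simp only: C_diff.simps differentiable_def) blast
qed

text \<open>The bump lives on twice the radius, so it is positive wherever \<open>v\<close> may be
  nonzero; being at most 1, it does not enlarge the error of the polynomial.\<close>

lemma test_function_uniform_approx:
  fixes v :: "'a::euclidean_space \<Rightarrow> real"
  assumes v: "continuous_on UNIV v" "\<And>x. x \<notin> ball 0 \<rho> \<Longrightarrow> v x = 0" and \<rho>: "\<rho> > 0" and e: "e > 0"
  obtains g where "g \<in> test_functions" "\<And>x. \<bar>v x - g x\<bar> \<le> e"
proof -
  define q :: "'a \<Rightarrow> real" where "q x = 1 - (x \<bullet> x) / (2 * \<rho>)\<^sup>2" for x
  define b where "b x = flat_exp 0 (q x)" for x
  have qpos: "q x > 0 \<longleftrightarrow> x \<in> ball 0 (2 * \<rho>)" for x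
  proof -
    have "q x > 0 \<longleftrightarrow> (norm x)\<^sup>2 < (2 * \<rho>)\<^sup>2"
      unfolding q_def dot_square_norm using \<rho> by (simp add: field_simps)
    also have "\<dots> \<longleftrightarrow> norm x < 2 * \<rho>"
      using \<rho> power_mono_iff[of "2 * \<rho>" "norm x" 2] unfolding not_le[symmetric] by simp
    finally show ?thesis by simp
  qed
  have bpos: "b x > 0" if "x \<in> ball 0 (2 * \<rho>)" for x
    using qpos[of x] that by (simp add: b_def flat_exp_def)
  have b0: "b x = 0" if "x \<notin> ball 0 (2 * \<rho>)" for x
    using qpos[of x] that by (simp add: b_def flat_exp_def)
  have b1: "0 \<le> b x" "b x \<le> 1" for x by (auto simp: b_def flat_exp_def)
  have qp: "real_polynomial_function q"
  proof -
    have "real_polynomial_function (\<lambda>x::'a. \<Sum>i\<in>Basis. (x \<bullet> i) * (x \<bullet> i))"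
      by (intro real_polynomial_function_sum real_polynomial_function.intros(4) real_polynomial_function.intros(1)
          bounded_linear_inner_left) auto
    then have "real_polynomial_function (\<lambda>x::'a. x \<bullet> x)"
      by (simp add: euclidean_inner[symmetric])
    then show ?thesis
      unfolding q_def
      by (intro real_polynomial_function_diff real_polynomial_function_divide real_polynomial_function.intros(2))
  qed
  have Cb: "C_diff k (\<lambda>x. P x * b x)" if "real_polynomial_function P" for P k
    unfolding b_def by (rule C_diff_polynomial_flat_exp[OF qp that])
  have bc: "continuous_on UNIV b"
    using Cb[OF real_polynomial_function.intros(2)[of 1], of 0] by simp
  (* Approximating v / b instead of v makes the polynomial times b the desired test function. *)
  have "continuous_on (ball 0 (2 * \<rho>) \<union> - cball 0 \<rho>) (\<lambda>x. v x / b x)"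
  proof (rule continuous_on_open_Un)
    show "continuous_on (ball 0 (2 * \<rho>)) (\<lambda>x. v x / b x)"
      using bpos by (intro continuous_on_divide continuous_on_subset[OF v(1)] continuous_on_subset[OF bc])
        (auto simp: less_imp_neq[symmetric])
    show "continuous_on (- cball 0 \<rho>) (\<lambda>x. v x / b x)"
    proof (rule continuous_on_eq[OF continuous_on_const])
      \<comment> \<open>This holds also where \<open>b\<close> vanishes, since 0 / 0 is 0; the
        closed ball below contains such points.\<close>
      show "0 = v x / b x" if "x \<in> - cball 0 \<rho>" for x using v(2)[of x] that by auto
    qed
  qed auto
  moreover have "ball 0 (2 * \<rho>) \<union> - cball 0 \<rho> = (UNIV :: 'a set)" using \<rho> by auto
  ultimately have "continuous_on (cball 0 (2 * \<rho>)) (\<lambda>x. v x / b x)"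
    using continuous_on_subset by (metis subset_UNIV)
  from Stone_Weierstrass_real_polynomial_function[OF compact_cball this e]
  obtain P where P: "real_polynomial_function P" "\<And>x. x \<in> cball 0 (2 * \<rho>) \<Longrightarrow> \<bar>v x / b x - P x\<bar> < e"
    by blast
  show ?thesis
  proof (rule that[of "\<lambda>x. P x * b x"])
    have "closure {x. P x * b x \<noteq> 0} \<subseteq> cball 0 (2 * \<rho>)"
      using b0 by (intro closure_minimal) (force simp: less_imp_le not_less)+
    then have "compact (closure {x. P x * b x \<noteq> 0})"
      by (meson bounded_cball bounded_subset closed_closure compact_eq_bounded_closed)
    then show "(\<lambda>x. P x * b x) \<in> test_functions"
      unfolding test_functions_def using Cb[OF P(1)] by simp
    show "\<bar>v x - P x * b x\<bar> \<le> e" for x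
    proof (cases "x \<in> ball 0 (2 * \<rho>)")
      case True
      have "v x - P x * b x = b x * (v x / b x - P x)" using bpos[OF True] by (simp add: field_simps)
      also have "\<bar>\<dots>\<bar> = b x * \<bar>v x / b x - P x\<bar>" using b1 by (simp add: abs_mult)
      also have "\<dots> \<le> 1 * e" using b1 P(2)[of x] True by (intro mult_mono) auto
      finally show ?thesis by simp
    next
      case False
      then have "v x = 0" using \<rho> by (intro v(2)) auto
      then show ?thesis using b0[OF False] e by simp
    qed
  qed
qed

subsection \<open>The maximal function on CMO\<close>

text \<open>Sufficiency half of the characterisation of CMO by mean oscillation vanishing on small,
  on large and on distant balls.\<close>

lemma vanishing_mean_osc_imp_CMO:
  fixes F :: "'a::euclidean_space \<Rightarrow> real"
  assumes F: "F \<in> BMO"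
    and van: "\<And>e. e > 0 \<Longrightarrow> \<exists>\<delta>>0. \<exists>R>0. \<forall>c r. 0 < r \<longrightarrow> r \<le> \<delta> \<or> R \<le> r \<or> R \<le> norm c \<longrightarrow> mean_osc F c r \<le> e"
  shows "F \<in> CMO"
proof -
  let ?n = "DIM('a)"
  have Fl: "locally_integrable F" using F by (simp add: BMO_def)
  \<comment> \<open>Errors in units of e: smoothing, then cutting off a function whose relevant
    oscillation is at most (1 + 6 * 20^n) e, then 2 for the uniform approximation.\<close>
  define C where "C = 6 * 20 ^ ?n + 6 * 16 ^ ?n * (1 + 6 * 20 ^ ?n) + (2::real)"
  have C: "C > 0" unfolding C_def by (intro add_nonneg_pos add_nonneg_nonneg mult_nonneg_nonneg) auto
  have "\<exists>g\<in>test_functions. bmo_norm (\<lambda>x. F x - g x) < ennreal e0" if e0: "e0 > 0" for e0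
  proof -
    define e where "e = e0 / (2 * C)"
    have e: "e > 0" using e0 C by (simp add: e_def)
    obtain \<delta> R where \<delta>: "\<delta> > 0" and R: "R > 0"
      and osc: "\<And>c r. 0 < r \<Longrightarrow> r \<le> \<delta> \<or> R \<le> r \<or> R \<le> norm c \<Longrightarrow> mean_osc F c r \<le> e"
      using van[OF e] by blast
    define u where "u x = ball_avg F x (\<delta> / 2)" for x
    have uc: "continuous_on UNIV u" unfolding u_def using \<delta> by (intro continuous_on_ball_avg Fl) simp
    have ul: "locally_integrable u" by (rule locally_integrable_continuous[OF uc])
    have Ful: "locally_integrable (\<lambda>x. F x - u x)" by (rule locally_integrable_diff[OF Fl ul])
    have d1: "mean_osc (\<lambda>x. F x - u x) c r \<le> 6 * 20 ^ ?n * e" if "r > 0" for c r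
      unfolding u_def using \<delta> osc that by (intro mean_osc_diff_ball_avg_le Fl e) auto
    \<comment> \<open>\<open>u\<close> inherits its oscillation from F and F - u;
      \<open>4 * R / 4\<close> has the shape required by the cutoff with T = 4R.\<close>
    have oscu: "mean_osc u c r \<le> (1 + 6 * 20 ^ ?n) * e" if "0 < r" "4 * R / 4 \<le> r \<or> 4 * R / 4 \<le> norm c" for c r
    proof -
      have "mean_osc (\<lambda>x. F x - (F x - u x)) c r \<le> mean_osc F c r + mean_osc (\<lambda>x. F x - u x) c r"
        by (rule mean_osc_diff_le[OF Fl Ful])
      then have "mean_osc u c r \<le> mean_osc F c r + mean_osc (\<lambda>x. F x - u x) c r" by simp
      also have "\<dots> \<le> e + 6 * 20 ^ ?n * e" using that by (intro add_mono osc d1) auto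
      finally show ?thesis by (simp add: distrib_right)
    qed
    have e': "(1 + 6 * 20 ^ ?n) * e > 0" using e by (intro mult_pos_pos add_pos_nonneg) auto
    obtain v where v: "continuous_on UNIV v" "\<And>x. x \<notin> ball 0 (2 * (4 * R)) \<Longrightarrow> v x = 0"
      and d2: "\<And>c r. 0 < r \<Longrightarrow> mean_osc (\<lambda>x. u x - v x) c r \<le> 6 * 16 ^ ?n * ((1 + 6 * 20 ^ ?n) * e)"
      by (rule mean_osc_cutoff[where T = "4 * R", OF uc _ e' oscu]) (use R in auto)
    obtain g where g: "g \<in> test_functions" "\<And>x. \<bar>v x - g x\<bar> \<le> e"
      by (rule test_function_uniform_approx[where \<rho> = "2 * (4 * R)", OF v _ e]) (use R in auto)
    have vl: "locally_integrable v" by (rule locally_integrable_continuous[OF v(1)])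
    have "C_diff 0 g" using g(1) unfolding test_functions_def by blast
    then have gl: "locally_integrable g" by (simp add: locally_integrable_continuous)
    have uvl: "locally_integrable (\<lambda>x. u x - v x)" by (rule locally_integrable_diff[OF ul vl])
    have vgl: "locally_integrable (\<lambda>x. v x - g x)" by (rule locally_integrable_diff[OF vl gl])
    have "mean_osc (\<lambda>x. F x - g x) c r \<le> C * e" if r: "r > 0" for c r
    proof -
      have "mean_osc (\<lambda>x. (F x - u x) + ((u x - v x) + (v x - g x))) c r
          \<le> mean_osc (\<lambda>x. F x - u x) c r + (mean_osc (\<lambda>x. u x - v x) c r + mean_osc (\<lambda>x. v x - g x) c r)"
        by (intro order_trans[OF mean_osc_add_le] add_left_mono mean_osc_add_le locally_integrable_add
            Ful uvl vgl)
      moreover have "mean_osc (\<lambda>x. v x - g x) c r \<le> 2 * e"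
      proof -
        have "ball_avg (\<lambda>x. norm (v x - g x)) c r \<le> ball_avg (\<lambda>x. e) c r"
          using g(2) by (intro ball_avg_mono locally_integrable_norm[OF vgl] locally_integrable_const) simp
        then show ?thesis using mean_osc_le_avg[OF vgl r, of c] ball_avg_const[OF r, of e c] by simp
      qed
      ultimately have "mean_osc (\<lambda>x. F x - g x) c r
          \<le> 6 * 20 ^ ?n * e + (6 * 16 ^ ?n * ((1 + 6 * 20 ^ ?n) * e) + 2 * e)"
        using d1[OF r, of c] d2[OF r, of c] by simp
      also have "\<dots> = C * e" unfolding C_def by (simp add: algebra_simps)
      finally show ?thesis .
    qed
    then have "bmo_norm (\<lambda>x. F x - g x) \<le> ennreal (C * e)"
      using C e by (subst bmo_norm_le_iff) auto
    also have "\<dots> < ennreal e0" using C e0 by (intro ennreal_lessI) (auto simp: e_def)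
    finally show ?thesis using g(1) by blast
  qed
  then show ?thesis using F by (simp add: CMO_def)
qed

lemma test_function_support_bound:
  fixes g :: "'a::euclidean_space \<Rightarrow> 'b::euclidean_space"
  assumes "g \<in> test_functions"
  obtains S G where "S > 0" "\<And>x. x \<notin> ball 0 S \<Longrightarrow> g x = 0" "G > 0" "\<And>x. norm (g x) \<le> G"
proof -
  have "C_diff 0 g" "compact (closure {x. g x \<noteq> 0})" using assms unfolding test_functions_def by blast+
  then have gc: "continuous_on UNIV g" and "bounded {x. g x \<noteq> 0}"
    by (auto simp: compact_imp_bounded bounded_closure_image intro: bounded_subset[OF compact_imp_bounded closure_subset])
  then obtain S where S: "S > 0" "{x. g x \<noteq> 0} \<subseteq> ball 0 S" using bounded_subset_ballD by blast
  have "compact (g ` cball 0 S)"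
    by (intro compact_continuous_image continuous_on_subset[OF gc] compact_cball) simp
  then obtain G where G: "G > 0" "\<And>y. y \<in> g ` cball 0 S \<Longrightarrow> norm y \<le> G"
    using compact_imp_bounded bounded_pos by metis
  have "norm (g x) \<le> G" for x
  proof (cases "g x = 0")
    case False
    then have "x \<in> cball 0 S" using S(2) by auto
    then show ?thesis using G(2) by blast
  qed (use G(1) in simp)
  then show ?thesis using S G(1) by (intro that[of S G]) auto
qed

lemma test_function_uniformly_continuous:
  fixes g :: "'a::euclidean_space \<Rightarrow> 'b::euclidean_space"
  assumes g: "g \<in> test_functions" and e: "e > 0"
  obtains d where "d > 0" "\<And>x y. dist x y < d \<Longrightarrow> norm (g x - g y) \<le> e"
proof -
  have "C_diff 0 g" using g unfolding test_functions_def by blast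
  then have gc: "continuous_on UNIV g" by simp
  obtain S where S: "S > 0" "\<And>x. x \<notin> ball 0 S \<Longrightarrow> g x = 0"
    using test_function_support_bound[OF g] by metis
  have "uniformly_continuous_on (cball 0 (S + 1)) g"
    by (intro compact_uniformly_continuous continuous_on_subset[OF gc] compact_cball) simp
  then obtain d0 where d0: "d0 > 0"
    "\<And>x y. x \<in> cball 0 (S + 1) \<Longrightarrow> y \<in> cball 0 (S + 1) \<Longrightarrow> dist y x < d0 \<Longrightarrow> dist (g y) (g x) < e"
    using e unfolding uniformly_continuous_on_def by metis
  show ?thesis
  \<comment> \<open>Two points closer than 1, one of them outside \<open>cball 0 (S + 1)\<close>,
    both lie outside \<open>ball 0 S\<close>, where g is 0.\<close>
  proof (rule that[of "min d0 1"])
    show "min d0 1 > 0" using d0(1) by simp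
    fix x y :: 'a assume d: "dist x y < min d0 1"
    show "norm (g x - g y) \<le> e"
    proof (cases "x \<in> cball 0 (S + 1) \<and> y \<in> cball 0 (S + 1)")
      case True
      then show ?thesis using d0(2)[of y x] d by (simp add: dist_norm)
    next
      case False
      have "x \<notin> ball 0 S \<and> y \<notin> ball 0 S"
        using False d norm_triangle_sub[of x y] norm_triangle_sub[of y x]
        by (auto simp: dist_norm norm_minus_commute)
      then show ?thesis using S(2)[of x] S(2)[of y] e by simp
    qed
  qed
qed

text \<open>\<open>enn2real\<close> sends infinity to 0, so the first conclusion is what makes the
  real-valued function a faithful version of \<open>maximal f\<close>. The 36 is 18 doubled by
  recentring.\<close>

theorem maximal_CMO:
  fixes f :: "'a::euclidean_space \<Rightarrow> 'b::euclidean_space"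
  assumes f: "f \<in> CMO" and x0: "maximal f x0 \<noteq> \<infinity>"
  shows "AE x in lebesgue. maximal f x \<noteq> \<infinity>"
    and "(\<lambda>x. enn2real (maximal f x)) \<in> CMO"
    and "bmo_norm (\<lambda>x. enn2real (maximal f x)) \<le> ennreal (36 * 90 ^ DIM('a)) * bmo_norm f"
proof -
  let ?n = "DIM('a)" and ?F = "\<lambda>x. enn2real (maximal f x)"
  have fl: "locally_integrable f" and fin: "bmo_norm f < \<infinity>" using f by (auto simp: CMO_def BMO_def)
  obtain b where b: "bmo_norm f = ennreal b" "b \<ge> 0" using fin by (cases "bmo_norm f") auto
  have oscf: "mean_osc f c r \<le> b" if "r > 0" for c r
    using bmo_norm_le_iff[OF b(2), of f] b(1) that by simp
  have osc1: "mean_osc f c r \<le> b + t" if "r > 0" "t > 0" for c r t using oscf[OF that(1), of c] that(2) by simp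
  have b1: "b + 1 > 0" using b by simp
  note F = maximal_locally_finite[OF fl b1 osc1 x0, simplified]
  show ae: "AE x in lebesgue. maximal f x \<noteq> \<infinity>" using F(1) by simp
  have Fl: "locally_integrable ?F" using F(2) by simp
  \<comment> \<open>The excess estimate needs a positive bound while \<open>b\<close> may be 0; it
    is applied with b + s for arbitrarily small s, which keeps the bound homogeneous in the
    seminorm.\<close>
  have oscF: "mean_osc ?F c r \<le> 36 * 90 ^ ?n * b" if r: "r > 0" for c r
  proof (rule field_le_epsilon)
    fix t :: real assume t: "t > 0"
    define s where "s = t / (36 * 90 ^ ?n)"
    have "s > 0" using t by (simp add: s_def)
    then have s: "s > 0" "b + s > 0" using b(2) by auto
    have "mean_osc ?F c r \<le> 2 * (18 * 90 ^ ?n * (b + s))"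
    proof (rule maximal_mean_osc_le[OF fl r ae Fl])
      show "(\<integral>\<^sup>+x\<in>ball c r. (maximal f x - m) \<partial>lebesgue)
          \<le> ennreal (18 * 90 ^ ?n * (b + s)) * emeasure lebesgue (ball c r)"
        if "m = (INF y\<in>ball c r. maximal f y)" "m \<noteq> \<infinity>" for m
        using osc1 s(1) by (intro maximal_excess_bmo[OF fl s(2) _ r that]) auto
    qed (use s in auto)
    also have "\<dots> = 36 * 90 ^ ?n * b + t" by (simp add: s_def algebra_simps)
    finally show "mean_osc ?F c r \<le> 36 * 90 ^ ?n * b + t" .
  qed
  then have "bmo_norm ?F \<le> ennreal (36 * 90 ^ ?n * b)"
    using b by (subst bmo_norm_le_iff) auto
  then show bmo: "bmo_norm ?F \<le> ennreal (36 * 90 ^ ?n) * bmo_norm f"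
    unfolding b(1) using b(2) by (simp add: ennreal_mult)
  have "bmo_norm ?F < \<infinity>"
    using \<open>bmo_norm ?F \<le> ennreal (36 * 90 ^ ?n * b)\<close> by (rule order.strict_trans1) simp
  with Fl have "?F \<in> BMO" by (simp add: BMO_def)
  then show "?F \<in> CMO"
  proof (rule vanishing_mean_osc_imp_CMO)
    fix e0 :: real assume e0: "e0 > 0"
    \<comment> \<open>108 = 2 * 54, recentring times the common constant of the two excess
      estimates.\<close>
    define e where "e = e0 / (108 * 90 ^ ?n)"
    have e: "e > 0" using e0 by (simp add: e_def)
    obtain g where g: "g \<in> test_functions" "bmo_norm (\<lambda>x. f x - g x) < ennreal e"
      using f e by (auto simp: CMO_def)
    have h: "mean_osc (\<lambda>x. f x - g x) c r \<le> e" if "r > 0" for c r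
      using bmo_norm_le_iff[of e "\<lambda>x. f x - g x"] g(2) e that by (simp add: less_imp_le)
    have "C_diff 0 g" using g(1) unfolding test_functions_def by blast
    then have gc: "continuous_on UNIV g" by simp
    obtain S G where S: "S > 0" "\<And>x. x \<notin> ball 0 S \<Longrightarrow> g x = 0" and G: "G > 0" "\<And>x. norm (g x) \<le> G"
      using test_function_support_bound[OF g(1)] by metis
    obtain d where d: "d > 0" "\<And>x y. dist x y < d \<Longrightarrow> norm (g x - g y) \<le> e"
      using test_function_uniformly_continuous[OF g(1) e] by blast
    obtain \<delta> where \<delta>: "\<delta> > 0"
      "\<And>c r m. 0 < r \<Longrightarrow> r \<le> \<delta> \<Longrightarrow> m = (INF y\<in>ball c r. maximal f y) \<Longrightarrow> m \<noteq> \<infinity> \<Longrightarrow>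
        (\<integral>\<^sup>+x\<in>ball c r. (maximal f x - m) \<partial>lebesgue)
          \<le> ennreal (54 * 90 ^ ?n * e) * emeasure lebesgue (ball c r)"
      using maximal_excess_osc_small[OF fl gc e h G d] by blast
    obtain R where R: "R > 0"
      "\<And>c r m. 0 < r \<Longrightarrow> R \<le> r \<or> R \<le> norm c \<Longrightarrow> m = (INF y\<in>ball c r. maximal f y) \<Longrightarrow> m \<noteq> \<infinity> \<Longrightarrow>
        (\<integral>\<^sup>+x\<in>ball c r. (maximal f x - m) \<partial>lebesgue)
          \<le> ennreal (54 * 90 ^ ?n * e) * emeasure lebesgue (ball c r)"
      using maximal_excess_far[OF fl gc e h G S] by blast
    have "mean_osc ?F c r \<le> e0" if r: "0 < r" "r \<le> \<delta> \<or> R \<le> r \<or> R \<le> norm c" for c r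
    proof -
      have "mean_osc ?F c r \<le> 2 * (54 * 90 ^ ?n * e)"
      proof (rule maximal_mean_osc_le[OF fl r(1) ae Fl])
        show "(\<integral>\<^sup>+x\<in>ball c r. (maximal f x - m) \<partial>lebesgue)
            \<le> ennreal (54 * 90 ^ ?n * e) * emeasure lebesgue (ball c r)"
          if m: "m = (INF y\<in>ball c r. maximal f y)" "m \<noteq> \<infinity>" for m
          using \<delta>(2)[OF r(1) _ m] R(2)[OF r(1) _ m] r(2) by blast
      qed (use e in auto)
      then show ?thesis by (simp add: e_def)
    qed
    then show "\<exists>\<delta>>0. \<exists>R>0. \<forall>c r. 0 < r \<longrightarrow> r \<le> \<delta> \<or> R \<le> r \<or> R \<le> norm c \<longrightarrow> mean_osc ?F c r \<le> e0"
      using \<delta>(1) R(1) by blast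
  qed
qed

text \<open>The sort of \<open>'b\<close> covers real-valued and complex-valued f at once. The
  constant depends on the dimension only.\<close>

theorem mainTheorem5:
  "\<exists>C::real. C > 0 \<and>
     (\<forall>f :: real ^ 'n \<Rightarrow> 'b::{real_normed_field, euclidean_space}.
        f \<in> CMO \<and> (\<exists>x. maximal f x \<noteq> \<infinity>) \<longrightarrow>
          (AE x in lebesgue. maximal f x \<noteq> \<infinity>) \<and>
          (\<lambda>x. enn2real (maximal f x)) \<in> CMO \<and>
          bmo_norm (\<lambda>x. enn2real (maximal f x)) \<le> ennreal C * bmo_norm f)"
proof (intro exI[of _ "36 * 90 ^ DIM(real ^ 'n)"] conjI allI impI)
  fix f :: "real ^ 'n \<Rightarrow> 'b"
  assume *: "f \<in> CMO \<and> (\<exists>x. maximal f x \<noteq> \<infinity>)"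
  then obtain x0 where "f \<in> CMO" "maximal f x0 \<noteq> \<infinity>" by blast
  note M = maximal_CMO[OF this]
  show "AE x in lebesgue. maximal f x \<noteq> \<infinity>" by (rule M(1))
  show "(\<lambda>x. enn2real (maximal f x)) \<in> CMO" by (rule M(2))
  show "bmo_norm (\<lambda>x. enn2real (maximal f x)) \<le> ennreal (36 * 90 ^ DIM(real ^ 'n)) * bmo_norm f"
    by (rule M(3))
qed simp

end
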